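(* Let $n\geq 0$ be an integer and let $a_0,a_1,\dots,a_n$ be complex numbers, not all zero. Define \[ \phi_F(t)=e^{-2\pi\cosh t}\Bigg(\sum_{m=0}^{n}a_m e^{-2\pi m e^{t}}\Bigg)\Bigg(\sum_{m=0}^{n}\overline{a_m}\, e^{-2\pi m e^{-t}}\Bigg),\qquad t\in\mathbb{R}, \] the entire function $\Xi_F(s)=\int_{-\infty}^{\infty}\phi_F(t)e^{ist}\,dt$, and $C_F(s)=\Xi_F(-is)$. Let \[ \psi_F(s)=\pi^{-s}\sum_{m=0}^{n}a_m(2m+1)^{-s}, \] let $P(y)=\sum_{m=0}^{n}a_m y^m$, and let $k\geq 0$ be the integer such that $P(1)=P'(1)=\cdots=P^{(k-1)}(1)=0$ and $P^{(k)}(1)\neq 0$. Let $\Delta_*<\Delta_{**}$ be positive real numbers and suppose that $\psi_F(s-k)$ has no zeros in the strip $-\Delta_{**}<\operatorname{Re} s<\Delta_*$. Let $\delta$ satisfy $0<\delta<\Delta_*$. Then all but finitely many zeros of $C_F(s)$ lying in $|\operatorname{Re} s|\leq\delta$ are on the line $\operatorname{Re} s=0$ and are simple.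
   Context: The functions $\Xi_F$ are approximations (introduced by H. Ki) of the Ramanujan $\Xi$-function; $k$ is the order of vanishing of the polynomial $P$ at $y=1$. *)

theory Defs
  imports "HOL-Analysis.Analysis" "HOL-Computational_Algebra.Polynomial"
begin

definition phiF :: "(nat \<Rightarrow> complex) \<Rightarrow> nat \<Rightarrow> real \<Rightarrow> complex" where
  "phiF a n t =
     complex_of_real (exp (- 2 * pi * cosh t))
     * (\<Sum>m\<le>n. a m * complex_of_real (exp (- 2 * pi * real m * exp t)))
     * (\<Sum>m\<le>n. cnj (a m) * complex_of_real (exp (- 2 * pi * real m * exp (- t))))"

definition XiF :: "(nat \<Rightarrow> complex) \<Rightarrow> nat \<Rightarrow> complex \<Rightarrow> complex" where
  "XiF a n s = (LBINT t. phiF a n t * exp (\<i> * s * complex_of_real t))"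

definition CF :: "(nat \<Rightarrow> complex) \<Rightarrow> nat \<Rightarrow> complex \<Rightarrow> complex" where
  "CF a n s = XiF a n (- \<i> * s)"

definition psiF :: "(nat \<Rightarrow> complex) \<Rightarrow> nat \<Rightarrow> complex \<Rightarrow> complex" where
  "psiF a n s = complex_of_real pi powr (- s) * (\<Sum>m\<le>n. a m * of_nat (2 * m + 1) powr (- s))"

definition PF :: "(nat \<Rightarrow> complex) \<Rightarrow> nat \<Rightarrow> complex poly" where
  "PF a n = (\<Sum>m\<le>n. monom (a m) m)"

end

theory Submission
  imports Defs "HOL-Complex_Analysis.Complex_Analysis" "HOL-Real_Asymp.Real_Asymp"
begin

text \<open>
  Expanding the two sums in $\phi_F$ writes $C_F$ as a combination of modified Bessel integrals
  $\int \exp(-\alpha e^t - \beta e^{-t} + st)\,dt$. Each of them splits as $G(s) + \widetilde G(-s)$,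
  where $G(s) = \Gamma(s)\,\alpha^{-s}\,{}_0F_1(;1-s;\alpha\beta)$ and $\widetilde G$ has $\alpha$, $\beta$
  exchanged: rescaling reduces this to $\alpha = \beta$, where all three functions solve the same three-term
  recurrence in $s$, and comparing Casorati determinants as $s \to \pm\infty$ identifies the solutions.
  Summation gives $C_F(s) = g(s) + \overline{g(-\bar s)}$ with $g(s) = (-1)^k\,\Gamma(s-k)\,h(s)$, and
  $h(s) - c\,\psi_F(s-k)$ tends to $0$ at the ends of vertical strips, with $c \neq 0$.

  An exponential sum without zeros in an open strip is bounded away from zero on closed substrips, so
  $h'/h$ is bounded there, whereas the real part of $\Gamma'/\Gamma$ tends to infinity with
  $|\mathrm{Im}\, s|$. Hence $\mathrm{Re}\,(g'/g) > 0$ high up in the strip. So $|g|$ increases strictly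
  with the real part, which forces zeros of $C_F$ onto the imaginary axis; on the axis, a zero of
  $C_F = 2\,\mathrm{Re}\, g$ has $C_F' = 2 g\,\mathrm{Re}\,(g'/g) \neq 0$.
\<close>

subsection \<open>Two-sided Laplace transforms\<close>

lemma sum_power_div_fact_le_exp:
  fixes u :: real
  assumes "u \<ge> 0" "finite J"
  shows "(\<Sum>j\<in>J. u ^ j / fact j) \<le> exp u"
proof -
  have "(\<Sum>j\<in>J. u ^ j /\<^sub>R fact j) \<le> (\<Sum>j. u ^ j /\<^sub>R fact j)"
    using assms by (intro sum_le_suminf summable_exp_generic) auto
  then show ?thesis
    by (simp add: exp_def divide_inverse mult.commute)
qed

lemma integrable_mult_exp_abs:
  fixes w :: "real \<Rightarrow> complex"
  assumes "\<And>r::real. integrable lborel (\<lambda>t. w t * of_real (exp (r * t)))" "r \<ge> 0"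
  shows "integrable lborel (\<lambda>t. norm (w t) * exp (r * \<bar>t\<bar>))"
proof (rule Bochner_Integration.integrable_bound)
  show "integrable lborel (\<lambda>t. norm (w t * of_real (exp (r * t))) + norm (w t * of_real (exp (- r * t))))"
    using assms(1)[of r] assms(1)[of "- r"] by (intro Bochner_Integration.integrable_add integrable_norm)
  have "w \<in> borel_measurable lborel"
    using borel_measurable_integrable[OF assms(1)[of 0]] by simp
  then show "(\<lambda>t. norm (w t) * exp (r * \<bar>t\<bar>)) \<in> borel_measurable lborel"
    by measurable
  have "exp (r * \<bar>t\<bar>) \<le> exp (r * t) + exp (- r * t)" for t :: real
    by (auto simp: abs_if)
  then have "norm (w t) * exp (r * \<bar>t\<bar>) \<le> norm (w t) * (exp (r * t) + exp (- r * t))" for t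
    by (intro mult_left_mono) auto
  then show "AE t in lborel. norm (norm (w t) * exp (r * \<bar>t\<bar>)) \<le>
      norm (norm (w t * of_real (exp (r * t))) + norm (w t * of_real (exp (- r * t))))"
    by (intro AE_I2) (simp add: norm_mult distrib_left)
qed

lemma sum_norm_exp_series_le:
  fixes w z :: complex
  assumes "finite J"
  shows "(\<Sum>j\<in>J. norm (w * (z ^ j / fact j))) \<le> norm w * exp (norm z)"
proof -
  have "(\<Sum>j\<in>J. norm (w * (z ^ j / fact j))) = norm w * (\<Sum>j\<in>J. norm z ^ j / fact j)"
    by (simp add: norm_mult norm_divide norm_power sum_distrib_left)
  also have "\<dots> \<le> norm w * exp (norm z)"
    using assms by (intro mult_left_mono sum_power_div_fact_le_exp) auto
  finally show ?thesis .
qed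

lemma two_sided_Laplace_sums:
  fixes w :: "real \<Rightarrow> complex"
  assumes w: "\<And>r::real. integrable lborel (\<lambda>t. w t * of_real (exp (r * t)))"
  shows "(\<lambda>j. (LBINT t. w t * of_real t ^ j / fact j) * s ^ j) sums (LBINT t. w t * exp (s * of_real t))"
proof -
  define f where "f j t = w t * ((s * of_real t) ^ j / fact j)" for j :: nat and t :: real
  have bound: "(\<Sum>j\<in>J. norm (f j t)) \<le> norm (w t) * exp (norm s * \<bar>t\<bar>)" if "finite J" for J t
    using sum_norm_exp_series_le[OF that, of "w t" "s * of_real t"] by (simp add: f_def norm_mult)
  note dominating = integrable_mult_exp_abs[OF w norm_ge_zero[of s]]
  have [measurable]: "w \<in> borel_measurable lborel"
    using borel_measurable_integrable[OF w[of 0]] by simp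
  have f_int: "integrable lborel (f j)" for j
  proof (rule Bochner_Integration.integrable_bound[OF dominating])
    show "f j \<in> borel_measurable lborel"
      unfolding f_def by measurable
    show "AE t in lborel. norm (f j t) \<le> norm (norm (w t) * exp (norm s * \<bar>t\<bar>))"
      using bound[of "{j}"] by simp
  qed
  have "(\<lambda>N. LBINT t. \<Sum>j<N. f j t) \<longlonglongrightarrow> (LBINT t. w t * exp (s * of_real t))"
  proof (rule integral_dominated_convergence[OF _ _ dominating])
    have "(\<lambda>j. f j t) sums (w t * exp (s * of_real t))" for t
      using sums_mult[OF exp_converges[of "s * of_real t"], of "w t"]
      by (simp add: f_def scaleR_conv_of_real divide_inverse mult.commute)
    then show "AE t in lborel. (\<lambda>N. \<Sum>j<N. f j t) \<longlonglongrightarrow> w t * exp (s * of_real t)"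
      by (simp add: sums_def)
    show "AE t in lborel. norm (\<Sum>j<N. f j t) \<le> norm (w t) * exp (norm s * \<bar>t\<bar>)" for N
      using order_trans[OF norm_sum bound[of "{..<N}"]] by simp
    show "(\<lambda>t. \<Sum>j<N. f j t) \<in> borel_measurable lborel" for N
      using f_int by (intro borel_measurable_sum borel_measurable_integrable)
  qed measurable
  moreover have "(LBINT t. f j t) = (LBINT t. w t * of_real t ^ j / fact j) * s ^ j" for j
    unfolding f_def by (subst integral_mult_left_zero [symmetric]) (simp add: power_mult_distrib mult_ac)
  ultimately show ?thesis
    using f_int by (simp add: sums_def)
qed

lemma two_sided_Laplace_holomorphic:
  fixes w :: "real \<Rightarrow> complex"
  assumes "\<And>r::real. integrable lborel (\<lambda>t. w t * of_real (exp (r * t)))"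
  shows "(\<lambda>s. LBINT t. w t * exp (s * of_real t)) holomorphic_on A"
proof -
  have "(\<lambda>s. LBINT t. w t * exp (s * of_real t)) holomorphic_on ball 0 r" for r
    by (rule power_series_holomorphic) (simp only: diff_zero, rule two_sided_Laplace_sums[OF assms])
  moreover have "z \<in> ball 0 (norm z + 1)" for z :: complex
    by simp
  ultimately have "(\<lambda>s. LBINT t. w t * exp (s * of_real t)) field_differentiable at z" for z
    by (meson holomorphic_on_imp_differentiable_at open_ball)
  then show ?thesis
    by (simp add: field_differentiable_at_within holomorphic_on_def)
qed

subsection \<open>Modified Bessel integrals\<close>

definition scaled_Gamma :: "real \<Rightarrow> complex \<Rightarrow> complex" where
  "scaled_Gamma \<alpha> s = Gamma s * of_real \<alpha> powr (- s)"

lemma has_bochner_integral_Gamma_exp: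
  assumes "Re s > 0"
  shows "has_bochner_integral lborel (\<lambda>t::real. exp (of_real (- exp t) + s * of_real t)) (Gamma s)"
proof -
  define f where "f t = complex_of_real t powr (s - 1) / of_real (exp t)" for t :: real
  define h where "h t = exp (of_real (- exp t) + s * of_real t)" for t :: real
  have range_exp: "range (exp :: real \<Rightarrow> real) = {0<..}"
    by (auto simp: image_iff) (metis exp_ln)
  have substitution: "\<bar>exp t\<bar> *\<^sub>R f (exp t) = h t" for t :: real
    by (simp add: f_def h_def powr_def scaleR_conv_of_real exp_diff exp_add exp_minus
        exp_of_real [symmetric] divide_inverse algebra_simps flip: Ln_of_real)
  have "f absolutely_integrable_on range exp \<and> integral (range exp) f = Gamma s"
    unfolding range_exp f_def
    using absolutely_integrable_Gamma_integral'[OF assms] Gamma_integral_complex'[OF assms]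
    by (auto simp: integral_unique)
  then have "(\<lambda>t. \<bar>exp t\<bar> *\<^sub>R f (exp t)) absolutely_integrable_on UNIV \<and>
      integral UNIV (\<lambda>t. \<bar>exp t\<bar> *\<^sub>R f (exp t)) = Gamma s"
    by (subst has_absolute_integral_change_of_variables_real)
       (auto intro!: derivative_eq_intros inj_onI)
  then have "set_integrable lebesgue UNIV h" and integral_h: "integral UNIV h = Gamma s"
    unfolding substitution by auto
  moreover have "h \<in> borel_measurable lborel"
    unfolding h_def by measurable
  ultimately have "integrable lborel h"
    by (simp add: set_integrable_def integrable_completion)
  then have "has_bochner_integral lborel h (Gamma s)"
    using integral_lborel[of h] integral_h by (simp add: has_bochner_integral_iff)
  then show ?thesis
    by (simp only: h_def [abs_def])
qed

definition bessel_integrand :: "real \<Rightarrow> real \<Rightarrow> complex \<Rightarrow> real \<Rightarrow> complex" where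
  "bessel_integrand \<alpha> \<beta> s t = exp (of_real (- \<alpha> * exp t - \<beta> * exp (- t)) + s * of_real t)"

text \<open>Equals $2 (\beta/\alpha)^{s/2} K_s(2\sqrt{\alpha\beta})$ for $\alpha, \beta > 0$.\<close>

definition bessel_integral :: "real \<Rightarrow> real \<Rightarrow> complex \<Rightarrow> complex" where
  "bessel_integral \<alpha> \<beta> s = (LBINT t. bessel_integrand \<alpha> \<beta> s t)"

lemma bessel_integrand_measurable [measurable]: "bessel_integrand \<alpha> \<beta> s \<in> borel_measurable borel"
  unfolding bessel_integrand_def by measurable

lemma norm_bessel_integrand:
  "norm (bessel_integrand \<alpha> \<beta> s t) = exp (- \<alpha> * exp t - \<beta> * exp (- t) + Re s * t)"
  by (simp add: bessel_integrand_def)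

lemma bessel_integrand_uminus: "bessel_integrand \<alpha> \<beta> s (- t) = bessel_integrand \<beta> \<alpha> (- s) t"
  by (simp add: bessel_integrand_def algebra_simps)

lemma has_bochner_integral_bessel_integrand_0:
  assumes "Re s > 0" "\<alpha> > 0"
  shows "has_bochner_integral lborel (bessel_integrand \<alpha> 0 s) (scaled_Gamma \<alpha> s)"
proof -
  define h where "h t = exp (of_real (- exp t) + s * of_real t)" for t :: real
  have "has_bochner_integral lborel (\<lambda>t. h (ln \<alpha> + 1 * t)) (Gamma s /\<^sub>R \<bar>1\<bar>)"
    using has_bochner_integral_Gamma_exp[OF assms(1)]
    by (subst lborel_has_bochner_integral_real_affine_iff[symmetric]) (simp_all add: h_def [abs_def])
  then have "has_bochner_integral lborel (\<lambda>t. h (ln \<alpha> + 1 * t) * of_real \<alpha> powr (- s))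
      (Gamma s * of_real \<alpha> powr (- s))"
    by (intro has_bochner_integral_mult_left) simp
  moreover have "h (ln \<alpha> + 1 * t) * of_real \<alpha> powr (- s) = bessel_integrand \<alpha> 0 s t" for t
    using assms(2)
    by (simp add: h_def bessel_integrand_def powr_def exp_add [symmetric] Ln_of_real algebra_simps)
       (simp add: exp_add mult.commute)
  ultimately show ?thesis
    by (simp add: scaled_Gamma_def)
qed

lemma norm_bessel_integrand_le_add:
  assumes "\<alpha> \<ge> 0" "\<beta> \<ge> 0" "\<bar>Re s\<bar> \<le> R"
  shows "norm (bessel_integrand \<alpha> \<beta> s t) \<le>
    norm (bessel_integrand \<alpha> 0 (of_real R) t) + norm (bessel_integrand 0 \<beta> (of_real (- R)) t)"
proof -
  have "Re s * t \<le> \<bar>Re s\<bar> * \<bar>t\<bar>"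
    using abs_ge_self[of "Re s * t"] by (simp add: abs_mult)
  also have "\<dots> \<le> R * \<bar>t\<bar>"
    using assms(3) by (intro mult_right_mono) auto
  finally have exponent: "Re s * t \<le> R * \<bar>t\<bar>" .
  have "0 \<le> \<beta> * exp (- t)" "0 \<le> \<alpha> * exp t"
    using assms by simp_all
  then have "norm (bessel_integrand \<alpha> \<beta> s t) \<le>
      (if t \<ge> 0 then norm (bessel_integrand \<alpha> 0 (of_real R) t)
       else norm (bessel_integrand 0 \<beta> (of_real (- R)) t))"
    using exponent by (auto simp: norm_bessel_integrand)
  then show ?thesis
    using norm_ge_zero[of "bessel_integrand \<alpha> 0 (of_real R) t"]
      norm_ge_zero[of "bessel_integrand 0 \<beta> (of_real (- R)) t"]
    by (simp only: split: if_splits)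
qed

lemma integrable_bessel_integrand:
  assumes "\<alpha> > 0" "\<beta> > 0"
  shows "integrable lborel (bessel_integrand \<alpha> \<beta> s)"
proof -
  define R where "R = \<bar>Re s\<bar> + 1"
  have gamma: "integrable lborel (bessel_integrand \<gamma> 0 (of_real R))" if "\<gamma> > 0" for \<gamma>
    using has_bochner_integral_bessel_integrand_0[of "of_real R" \<gamma>] that
    by (simp add: R_def has_bochner_integral_iff)
  have "integrable lborel (\<lambda>t. bessel_integrand \<beta> 0 (of_real R) (0 + (- 1) * t))"
    using gamma[OF assms(2)] by (intro lborel_integrable_real_affine) auto
  then have "integrable lborel (bessel_integrand 0 \<beta> (of_real (- R)))"
    by (simp add: bessel_integrand_uminus)
  with gamma[OF assms(1)] have "integrable lborel (\<lambda>t.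
      norm (bessel_integrand \<alpha> 0 (of_real R) t) + norm (bessel_integrand 0 \<beta> (of_real (- R)) t))"
    by (intro Bochner_Integration.integrable_add integrable_norm)
  then show ?thesis
  proof (rule Bochner_Integration.integrable_bound)
    show "AE t in lborel. norm (bessel_integrand \<alpha> \<beta> s t) \<le>
        norm (norm (bessel_integrand \<alpha> 0 (of_real R) t) + norm (bessel_integrand 0 \<beta> (of_real (- R)) t))"
      using norm_bessel_integrand_le_add[of \<alpha> \<beta> s R] assms by (simp add: R_def)
  qed measurable
qed

lemma bessel_integral_holomorphic:
  assumes "\<alpha> > 0" "\<beta> > 0"
  shows "bessel_integral \<alpha> \<beta> holomorphic_on A"
proof -
  have factor: "bessel_integrand \<alpha> \<beta> s = (\<lambda>t. bessel_integrand \<alpha> \<beta> 0 t * exp (s * of_real t))" for s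
    by (simp add: bessel_integrand_def fun_eq_iff exp_add)
  have "integrable lborel (\<lambda>t. bessel_integrand \<alpha> \<beta> 0 t * of_real (exp (r * t)))" for r
    using integrable_bessel_integrand[OF assms, of "of_real r"]
    by (subst (asm) factor) (simp flip: exp_of_real)
  from two_sided_Laplace_holomorphic[OF this] show ?thesis
    unfolding bessel_integral_def [abs_def] factor[symmetric] .
qed

lemma bessel_integral_swap: "bessel_integral \<alpha> \<beta> s = bessel_integral \<beta> \<alpha> (- s)"
  unfolding bessel_integral_def
  using lborel_integral_real_affine[of "-1" "bessel_integrand \<alpha> \<beta> s" 0]
  by (simp add: bessel_integrand_uminus)

lemma bessel_integral_scale:
  assumes "c > 0"
  shows "bessel_integral \<alpha> \<beta> s = of_real c powr s * bessel_integral (\<alpha> * c) (\<beta> / c) s"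
proof -
  have "bessel_integrand \<alpha> \<beta> s (ln c + 1 * t) =
      of_real c powr s * bessel_integrand (\<alpha> * c) (\<beta> / c) s t" for t
  proof -
    have "exp (ln c + 1 * t) = c * exp t" "exp (- (ln c + 1 * t)) = exp (- t) / c"
      using assms by (simp_all add: exp_add exp_diff exp_minus field_simps)
    then show ?thesis
      using assms unfolding bessel_integrand_def
      by (simp add: powr_def Ln_of_real algebra_simps flip: exp_add)
  qed
  then show ?thesis
    unfolding bessel_integral_def
    using lborel_integral_real_affine[of 1 "bessel_integrand \<alpha> \<beta> s" "ln c"] by simp
qed

lemma bessel_integrand_has_vector_derivative:
  "(bessel_integrand \<alpha> \<beta> s has_vector_derivative
     s * bessel_integrand \<alpha> \<beta> s t + \<beta> * bessel_integrand \<alpha> \<beta> (s - 1) t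
     - \<alpha> * bessel_integrand \<alpha> \<beta> (s + 1) t) (at t)"
  (is "(_ has_vector_derivative ?D) _")
proof -
  have "?D = bessel_integrand \<alpha> \<beta> s t * (s + of_real (\<beta> * exp (- t) - \<alpha> * exp t))"
    by (simp add: bessel_integrand_def algebra_simps exp_add exp_diff exp_minus
        exp_of_real [symmetric] divide_inverse)
  then have "((\<lambda>z. exp (- \<alpha> * exp z - \<beta> * exp (- z) + s * z)) has_field_derivative ?D) (at (of_real t))"
    unfolding bessel_integrand_def
    by (auto intro!: derivative_eq_intros simp: algebra_simps exp_of_real [symmetric])
  from has_vector_derivative_real_field[OF this] show ?thesis
    by (simp add: bessel_integrand_def [abs_def] exp_of_real [symmetric])
qed

lemma bessel_integrand_tendsto_0:
  assumes "\<alpha> > 0" "\<beta> > 0"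
  shows "(bessel_integrand \<alpha> \<beta> s \<longlongrightarrow> 0) at_top" "(bessel_integrand \<alpha> \<beta> s \<longlongrightarrow> 0) at_bot"
proof -
  have "((\<lambda>t. exp (- \<alpha> * exp t - \<beta> * exp (- t) + Re s * t)) \<longlongrightarrow> 0) at_top"
    "((\<lambda>t. exp (- \<alpha> * exp t - \<beta> * exp (- t) + Re s * t)) \<longlongrightarrow> 0) at_bot"
    using assms by real_asymp+
  then show "(bessel_integrand \<alpha> \<beta> s \<longlongrightarrow> 0) at_top" "(bessel_integrand \<alpha> \<beta> s \<longlongrightarrow> 0) at_bot"
    unfolding norm_bessel_integrand [symmetric] by (auto intro: tendsto_norm_zero_cancel)
qed

lemma bessel_integral_recurrence:
  assumes "\<alpha> > 0" "\<beta> > 0"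
  shows "\<alpha> * bessel_integral \<alpha> \<beta> (s + 1) = s * bessel_integral \<alpha> \<beta> s + \<beta> * bessel_integral \<alpha> \<beta> (s - 1)"
proof -
  define f where "f = bessel_integrand \<alpha> \<beta>"
  define f' where "f' t = s * f s t + \<beta> * f (s - 1) t - \<alpha> * f (s + 1) t" for t
  have f_int: "integrable lborel (f s)" for s
    unfolding f_def using assms by (rule integrable_bessel_integrand)
  have "(LBINT t=-\<infinity>..\<infinity>. f' t) = 0 - 0"
  proof (rule interval_integral_FTC_integrable[where F = "f s"])
    show "(f s has_vector_derivative f' t) (at t)" for t
      unfolding f_def f'_def by (rule bessel_integrand_has_vector_derivative)
    show "isCont f' t" for t
      unfolding f'_def f_def bessel_integrand_def by (intro continuous_intros)
    show "set_integrable lborel (einterval (-\<infinity>) \<infinity>) f'"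
      unfolding f'_def using f_int by (simp add: set_integrable_def)
    show "((f s \<circ> real_of_ereal) \<longlongrightarrow> 0) (at_right (-\<infinity>))" "((f s \<circ> real_of_ereal) \<longlongrightarrow> 0) (at_left \<infinity>)"
      unfolding ereal_tendsto_simps1 f_def using bessel_integrand_tendsto_0[OF assms] by simp_all
  qed simp
  then have "(LBINT t. f' t) = 0"
    by (simp add: interval_lebesgue_integral_def set_lebesgue_integral_def)
  then show ?thesis
    unfolding f'_def using f_int by (simp add: bessel_integral_def f_def)
qed

lemma has_bochner_integral_norm_bessel_integrand_0:
  assumes "Re s > 0" "\<alpha> > 0"
  shows "has_bochner_integral lborel (\<lambda>t. norm (bessel_integrand \<alpha> 0 s t)) (Gamma (Re s) * \<alpha> powr (- Re s))"
proof -
  define \<sigma> where "\<sigma> = Re s"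
  have "has_bochner_integral lborel (\<lambda>t. Re (bessel_integrand \<alpha> 0 (of_real \<sigma>) t))
      (Re (scaled_Gamma \<alpha> (of_real \<sigma>)))"
    using assms
    by (intro has_bochner_integral_Re has_bochner_integral_bessel_integrand_0) (simp_all add: \<sigma>_def)
  moreover have "Re (bessel_integrand \<alpha> 0 (of_real \<sigma>) t) = norm (bessel_integrand \<alpha> 0 s t)" for t
    by (simp add: bessel_integrand_def Re_exp \<sigma>_def)
  moreover have "scaled_Gamma \<alpha> (of_real \<sigma>) = of_real (Gamma \<sigma> * \<alpha> powr (- \<sigma>))"
    using assms(2) by (simp add: scaled_Gamma_def Gamma_complex_of_real powr_of_real flip: of_real_minus)
  ultimately show ?thesis
    by (simp only: Re_complex_of_real \<sigma>_def)
qed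

lemma norm_bessel_integrand_diff_le:
  assumes "\<beta> \<ge> 0"
  shows "norm (bessel_integrand \<alpha> \<beta> s t - bessel_integrand \<alpha> 0 s t)
    \<le> \<beta> * norm (bessel_integrand \<alpha> 0 (s - 1) t)"
proof -
  define u where "u = \<beta> * exp (- t)"
  have "u \<ge> 0" using assms by (simp add: u_def)
  have "bessel_integrand \<alpha> \<beta> s t - bessel_integrand \<alpha> 0 s t =
      bessel_integrand \<alpha> 0 s t * of_real (exp (- u) - 1)"
    by (simp add: bessel_integrand_def u_def algebra_simps exp_add exp_diff
        exp_of_real [symmetric] exp_minus divide_inverse)
  then have "norm (bessel_integrand \<alpha> \<beta> s t - bessel_integrand \<alpha> 0 s t) =
      norm (bessel_integrand \<alpha> 0 s t) * \<bar>exp (- u) - 1\<bar>"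
    by (simp only: norm_mult norm_of_real)
  also have "\<dots> \<le> norm (bessel_integrand \<alpha> 0 s t) * u"
    using exp_ge_add_one_self[of "- u"] \<open>u \<ge> 0\<close> by (intro mult_left_mono) auto
  also have "\<dots> = \<beta> * norm (bessel_integrand \<alpha> 0 (s - 1) t)"
    by (simp add: norm_bessel_integrand u_def field_simps exp_add exp_diff exp_minus)
  finally show ?thesis .
qed

lemma norm_bessel_integral_minus_scaled_Gamma_le:
  assumes "\<alpha> > 0" "\<beta> > 0" "Re s > 1"
  shows "norm (bessel_integral \<alpha> \<beta> s - scaled_Gamma \<alpha> s)
     \<le> \<beta> * (Gamma (Re s - 1) * \<alpha> powr (1 - Re s))"
proof -
  have diff_integral: "has_bochner_integral lborel (\<lambda>t. bessel_integrand \<alpha> \<beta> s t - bessel_integrand \<alpha> 0 s t)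
      (bessel_integral \<alpha> \<beta> s - scaled_Gamma \<alpha> s)"
    using integrable_bessel_integrand[OF assms(1,2), of s] assms
    by (intro has_bochner_integral_diff has_bochner_integral_bessel_integrand_0)
       (simp_all add: has_bochner_integral_iff bessel_integral_def)
  have majorant_integral: "has_bochner_integral lborel (\<lambda>t. \<beta> * norm (bessel_integrand \<alpha> 0 (s - 1) t))
      (\<beta> * (Gamma (Re s - 1) * \<alpha> powr (1 - Re s)))"
    using has_bochner_integral_norm_bessel_integrand_0[of "s - 1" \<alpha>] assms
    by (intro has_bochner_integral_mult_right) simp
  have "norm (LBINT t. bessel_integrand \<alpha> \<beta> s t - bessel_integrand \<alpha> 0 s t)
      \<le> (LBINT t. \<beta> * norm (bessel_integrand \<alpha> 0 (s - 1) t))"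
    using diff_integral majorant_integral norm_bessel_integrand_diff_le[of \<beta> \<alpha> s] assms(2)
    by (intro Bochner_Integration.integral_norm_bound_integral) (auto simp: has_bochner_integral_iff)
  then show ?thesis
    by (simp only: has_bochner_integral_integral_eq[OF diff_integral]
        has_bochner_integral_integral_eq[OF majorant_integral])
qed

subsection \<open>The confluent hypergeometric limit function\<close>

text \<open>For $k = 0$ this is ${}_0F_1(;z;x)$. In general $x^k/(z)_k$ times the tail at $z + k$ is the remainder
  of order $k$ of the series ${}_0F_1(;z;x)$.\<close>

definition hyp0F1_tail :: "nat \<Rightarrow> complex \<Rightarrow> complex \<Rightarrow> complex" where
  "hyp0F1_tail k x z = (\<Sum>i. x ^ i / (fact (k + i) * pochhammer z i))"

abbreviation hyp0F1 :: "complex \<Rightarrow> complex \<Rightarrow> complex" where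
  "hyp0F1 \<equiv> hyp0F1_tail 0"

lemma norm_pochhammer_ge:
  fixes z :: "'a :: real_normed_field"
  assumes "d \<ge> 0" "\<And>i. d \<le> norm (z + of_nat i)"
  shows "d ^ j \<le> norm (pochhammer z j)"
proof (induction j)
  case (Suc j)
  then have "d ^ j * d \<le> norm (pochhammer z j) * norm (z + of_nat j)"
    using assms by (intro mult_mono) auto
  then show ?case
    by (simp add: pochhammer_Suc norm_mult mult.commute)
qed simp

lemma norm_pochhammer_Suc_ge:
  fixes z :: "'a :: real_normed_field"
  assumes "d \<ge> 0" "\<And>i. d \<le> norm (z + of_nat i)"
  shows "norm z * d ^ j \<le> norm (pochhammer z (Suc j))"
proof -
  have "d \<le> norm (z + 1 + of_nat i)" for i
    using assms(2)[of "Suc i"] by (simp add: add_ac)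
  from norm_pochhammer_ge[OF assms(1) this] show ?thesis
    by (simp add: pochhammer_rec norm_mult mult_left_mono)
qed

lemma compact_separated_nonpos_Ints:
  fixes K :: "complex set"
  assumes "compact K" "K \<inter> \<int>\<^sub>\<le>\<^sub>0 = {}"
  obtains d where "d > 0" "\<And>z i. z \<in> K \<Longrightarrow> d \<le> norm (z + of_nat i)"
proof -
  obtain d where d: "d > 0" "\<And>z w. z \<in> K \<Longrightarrow> w \<in> \<int>\<^sub>\<le>\<^sub>0 \<Longrightarrow> d \<le> dist z w"
    using separate_compact_closed[OF assms(1) closed_nonpos_Ints assms(2)] by blast
  have "d \<le> norm (z + of_nat i)" if "z \<in> K" for z i
    using d(2)[OF that, of "- of_nat i"] by (simp add: dist_norm)
  with d(1) show ?thesis by (rule that)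
qed

lemma norm_hyp0F1_tail_term_le:
  fixes x z :: "'a :: real_normed_field"
  assumes "d > 0" "\<And>i. d \<le> norm (z + of_nat i)"
  shows "norm (x ^ i / (fact (k + i) * pochhammer z i)) \<le> (norm x / d) ^ i / fact i"
proof -
  have "norm (x ^ i / (fact (k + i) * pochhammer z i)) =
      norm x ^ i / (fact (k + i) * norm (pochhammer z i))"
    by (simp add: norm_divide norm_mult norm_power)
  also have "\<dots> \<le> norm x ^ i / (fact i * d ^ i)"
    using assms norm_pochhammer_ge[of d z i] by (intro frac_le mult_mono fact_mono) auto
  finally show ?thesis
    by (simp add: power_divide mult.commute)
qed

lemma exp_sums_divide_fact: "(\<lambda>i. r ^ i / fact i) sums exp (r :: real)"
  using exp_converges[of r] by (simp add: divide_inverse mult.commute)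

lemma hyp0F1_tail_sums:
  assumes "z \<notin> \<int>\<^sub>\<le>\<^sub>0"
  shows "(\<lambda>i. x ^ i / (fact (k + i) * pochhammer z i)) sums hyp0F1_tail k x z"
proof -
  obtain d where d: "d > 0" "\<And>i. d \<le> norm (z + of_nat i)"
    using compact_separated_nonpos_Ints[OF compact_sing, of z] assms
    by (metis Int_insert_left_if0 Int_empty_left singletonI)
  have "summable (\<lambda>i. x ^ i / (fact (k + i) * pochhammer z i))"
    by (rule summable_comparison_test'[OF sums_summable[OF exp_sums_divide_fact]
          norm_hyp0F1_tail_term_le[OF d]])
  then show ?thesis
    unfolding hyp0F1_tail_def by (rule summable_sums)
qed

lemma plus_of_nat_notin_nonpos_Ints: "z \<notin> \<int>\<^sub>\<le>\<^sub>0 \<Longrightarrow> z + of_nat n \<notin> \<int>\<^sub>\<le>\<^sub>0"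
  by (metis of_nat_in_Nats add_diff_cancel_right' nonpos_Ints_diff_Nats)

lemma hyp0F1_eq_partial_sum_plus_tail:
  assumes "z \<notin> \<int>\<^sub>\<le>\<^sub>0"
  shows "hyp0F1 x z = (\<Sum>j<k. x ^ j / (fact j * pochhammer z j)) +
    x ^ k / pochhammer z k * hyp0F1_tail k x (z + of_nat k)"
proof -
  have "z + of_nat k \<notin> \<int>\<^sub>\<le>\<^sub>0"
    using assms by (rule plus_of_nat_notin_nonpos_Ints)
  from sums_mult[OF hyp0F1_tail_sums[OF this], of "x ^ k / pochhammer z k" x k]
  have "(\<lambda>i. x ^ (k + i) / (fact (k + i) * pochhammer z (k + i))) sums
      (x ^ k / pochhammer z k * hyp0F1_tail k x (z + of_nat k))"
    by (simp add: pochhammer_product' power_add mult_ac)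
  then have "(\<lambda>i. x ^ (i + k) / (fact (i + k) * pochhammer z (i + k))) sums
      (x ^ k / pochhammer z k * hyp0F1_tail k x (z + of_nat k))"
    by (simp only: add.commute)
  then have "(\<lambda>i. x ^ i / (fact i * pochhammer z i)) sums
      (x ^ k / pochhammer z k * hyp0F1_tail k x (z + of_nat k) + (\<Sum>j<k. x ^ j / (fact j * pochhammer z j)))"
    by (subst (asm) sums_iff_shift)
  then show ?thesis
    using hyp0F1_tail_sums[OF assms, of x 0] by (simp add: sums_iff add.commute)
qed

lemma norm_hyp0F1_tail_minus_le:
  assumes d: "d > 0" "\<And>i. d \<le> norm (z + of_nat i)"
  shows "norm (hyp0F1_tail k x z - 1 / fact k) \<le> norm x * exp (norm x / d) / norm z"
proof -
  define f where "f i = x ^ i / (fact (k + i) * pochhammer z i)" for i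
  have "norm z > 0"
    using d(1) d(2)[of 0] by (metis add.right_neutral less_le_trans of_nat_0)
  have "z \<notin> \<int>\<^sub>\<le>\<^sub>0"
    using d by (metis add.left_inverse nonpos_Ints_cases' norm_zero not_le)
  from hyp0F1_tail_sums[OF this] have f_sums: "(\<lambda>i. f (Suc i)) sums (hyp0F1_tail k x z - 1 / fact k)"
    unfolding f_def by (subst sums_Suc_iff) simp
  have majorant: "(\<lambda>i. norm x / norm z * ((norm x / d) ^ i / fact i)) sums
      (norm x / norm z * exp (norm x / d))"
    by (intro sums_mult exp_sums_divide_fact)
  have "norm (f (Suc i)) \<le> norm x / norm z * ((norm x / d) ^ i / fact i)" for i
  proof -
    have "norm (f (Suc i)) = norm x ^ Suc i / (fact (k + Suc i) * norm (pochhammer z (Suc i)))"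
      by (simp add: f_def norm_divide norm_mult norm_power del: power_Suc fact_Suc)
    also have "\<dots> \<le> norm x ^ Suc i / (fact i * (norm z * d ^ i))"
      using d norm_pochhammer_Suc_ge[of d z i] \<open>norm z > 0\<close> by (intro frac_le mult_mono fact_mono) auto
    finally show ?thesis
      by (simp add: power_divide mult_ac)
  qed
  from norm_suminf_le[OF this sums_summable[OF majorant]]
  have "norm (\<Sum>i. f (Suc i)) \<le> (\<Sum>i. norm x / norm z * ((norm x / d) ^ i / fact i))" .
  then show ?thesis
    using sums_unique[OF f_sums] sums_unique[OF majorant] by simp
qed

lemma hyp0F1_tail_holomorphic:
  assumes "A \<inter> \<int>\<^sub>\<le>\<^sub>0 = {}"
  shows "hyp0F1_tail k x holomorphic_on A"
proof -
  have "hyp0F1_tail k x holomorphic_on (- \<int>\<^sub>\<le>\<^sub>0)"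
  proof (rule holomorphic_uniform_sequence)
    show open_compl: "open (- \<int>\<^sub>\<le>\<^sub>0 :: complex set)" by (simp add: open_Compl)
    show "(\<lambda>z. \<Sum>i<N. x ^ i / (fact (k + i) * pochhammer z i)) holomorphic_on - \<int>\<^sub>\<le>\<^sub>0" for N
      by (intro holomorphic_intros) (auto dest: pochhammer_eq_0_imp_nonpos_Int)
    fix z :: complex assume "z \<in> - \<int>\<^sub>\<le>\<^sub>0"
    then obtain r where r: "r > 0" "cball z r \<subseteq> - \<int>\<^sub>\<le>\<^sub>0"
      using open_compl open_contains_cball by blast
    then have "cball z r \<inter> \<int>\<^sub>\<le>\<^sub>0 = {}"
      by blast
    then obtain d where d: "d > 0" "\<And>w i. w \<in> cball z r \<Longrightarrow> d \<le> norm (w + of_nat i)"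
      using compact_separated_nonpos_Ints[OF compact_cball] by metis
    have "uniform_limit (cball z r) (\<lambda>N w. \<Sum>i<N. x ^ i / (fact (k + i) * pochhammer w i))
        (hyp0F1_tail k x) sequentially"
      unfolding hyp0F1_tail_def [abs_def]
      using norm_hyp0F1_tail_term_le[OF d] sums_summable[OF exp_sums_divide_fact]
      by (intro Weierstrass_m_test) auto
    with r show "\<exists>r>0. cball z r \<subseteq> - \<int>\<^sub>\<le>\<^sub>0 \<and> uniform_limit (cball z r)
        (\<lambda>N w. \<Sum>i<N. x ^ i / (fact (k + i) * pochhammer w i)) (hyp0F1_tail k x) sequentially"
      by blast
  qed
  then show ?thesis
    by (rule holomorphic_on_subset) (use assms in auto)
qed

lemma cnj_hyp0F1_tail:
  assumes "z \<notin> \<int>\<^sub>\<le>\<^sub>0"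
  shows "cnj (hyp0F1_tail k x z) = hyp0F1_tail k (cnj x) (cnj z)"
proof -
  have "(\<lambda>i. cnj (x ^ i / (fact (k + i) * pochhammer z i))) sums cnj (hyp0F1_tail k x z)"
    using hyp0F1_tail_sums[OF assms] by (simp only: sums_cnj)
  then show ?thesis
    by (simp add: hyp0F1_tail_def sums_iff)
qed

lemma inverse_pochhammer_contiguous:
  fixes z :: complex
  assumes "z \<notin> \<int>\<^sub>\<le>\<^sub>0"
  shows "1 / pochhammer z (Suc j) - 1 / pochhammer (z + 1) (Suc j) =
    of_nat (Suc j) / (z * (z + 1) * pochhammer (z + 2) j)"
proof -
  define p where "p = pochhammer (z + 2) j"
  have "z + 1 \<noteq> 0" "z + 1 + of_nat j \<noteq> 0" "p \<noteq> 0"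
    using plus_of_nat_notin_nonpos_Ints[OF assms, of 1] plus_of_nat_notin_nonpos_Ints[OF assms, of 2]
    by (auto simp: p_def dest: plus_of_nat_eq_0_imp pochhammer_eq_0_imp_nonpos_Int)
  moreover have "z \<noteq> 0"
    using assms by auto
  ultimately have nonzero: "z \<noteq> 0" "z + 1 \<noteq> 0" "z + 1 + of_nat j \<noteq> 0" "p \<noteq> 0"
    by simp_all
  have up: "pochhammer (z + 1) (Suc j) = (z + 1) * p"
    by (simp add: p_def pochhammer_rec add.assoc)
  then have "pochhammer (z + 1) j = (z + 1) * p / (z + 1 + of_nat j)"
    using nonzero by (simp add: pochhammer_Suc eq_divide_eq)
  then have "pochhammer z (Suc j) = z * ((z + 1) * p / (z + 1 + of_nat j))"
    by (simp add: pochhammer_rec)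
  then have "1 / pochhammer z (Suc j) - 1 / pochhammer (z + 1) (Suc j) =
      (z + 1 + of_nat j) / (z * ((z + 1) * p)) - 1 / ((z + 1) * p)"
    unfolding up by simp
  also have "\<dots> = of_nat (Suc j) / (z * (z + 1) * p)"
    using nonzero by (simp add: divide_simps)
  finally show ?thesis
    by (simp only: p_def)
qed

lemma hyp0F1_contiguous:
  assumes "z \<notin> \<int>\<^sub>\<le>\<^sub>0"
  shows "hyp0F1 x z = hyp0F1 x (z + 1) + x / (z * (z + 1)) * hyp0F1 x (z + 2)"
proof -
  define f where "f w j = x ^ j / (fact j * pochhammer w j)" for w j
  have "f w sums hyp0F1 x w" if "w \<notin> \<int>\<^sub>\<le>\<^sub>0" for w
    using hyp0F1_tail_sums[OF that, of x 0] by (simp add: f_def [abs_def])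
  then have f_sums: "f z sums hyp0F1 x z" "f (z + 1) sums hyp0F1 x (z + 1)"
      "f (z + 2) sums hyp0F1 x (z + 2)"
    using assms plus_of_nat_notin_nonpos_Ints[OF assms, of 1] plus_of_nat_notin_nonpos_Ints[OF assms, of 2]
    by simp_all
  have term_diff: "f z (Suc j) - f (z + 1) (Suc j) = x / (z * (z + 1)) * f (z + 2) j" for j
  proof -
    have "f z (Suc j) - f (z + 1) (Suc j) =
        x ^ Suc j / fact (Suc j) * (1 / pochhammer z (Suc j) - 1 / pochhammer (z + 1) (Suc j))"
      by (simp add: f_def right_diff_distrib del: power_Suc fact_Suc)
    also have "\<dots> = x / (z * (z + 1)) * f (z + 2) j"
      unfolding inverse_pochhammer_contiguous[OF assms] by (simp add: f_def fact_Suc del: of_nat_Suc)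
    finally show ?thesis .
  qed
  have "(\<lambda>j. f z (Suc j) - f (z + 1) (Suc j)) sums (hyp0F1 x z - hyp0F1 x (z + 1))"
    using sums_diff[OF f_sums(1,2)] by (subst sums_Suc_iff) (simp add: f_def)
  then have "hyp0F1 x z - hyp0F1 x (z + 1) = x / (z * (z + 1)) * hyp0F1 x (z + 2)"
    unfolding term_diff by (rule sums_unique2) (rule sums_mult[OF f_sums(3)])
  then show ?thesis
    by (simp add: diff_eq_eq add.commute)
qed

lemma hyp0F1_tendsto_1:
  assumes "z \<notin> \<int>"
  shows "(\<lambda>N. hyp0F1 x (z + of_nat N)) \<longlonglongrightarrow> 1" and "(\<lambda>N. hyp0F1 x (z - of_nat N)) \<longlonglongrightarrow> 1"
proof -
  obtain d where d: "d > 0" "\<And>w. w \<in> \<int> \<Longrightarrow> d \<le> dist z w"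
    using separate_point_closed[OF closed_Ints assms] by blast
  have translates: "(\<lambda>N. hyp0F1 x (z + f N)) \<longlonglongrightarrow> 1"
    if "\<And>N. f N \<in> \<int>" "filterlim f at_infinity sequentially" for f
  proof -
    have "d \<le> norm (z + f N + of_nat i)" for N i
      using d(2)[of "- (f N + of_nat i)"] that(1)[of N] by (simp add: dist_norm algebra_simps)
    then have "norm (hyp0F1 x (z + f N) - 1) \<le> norm (of_real (norm x * exp (norm x / d)) / (z + f N))" for N
      using norm_hyp0F1_tail_minus_le[OF d(1), of "z + f N" 0 x] by (simp add: norm_divide norm_mult)
    moreover have "(\<lambda>N. of_real (norm x * exp (norm x / d)) / (z + f N)) \<longlonglongrightarrow> 0"
      by (intro tendsto_divide_0[OF tendsto_const] tendsto_add_filterlim_at_infinity[OF tendsto_const]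
          that(2))
    ultimately show ?thesis
      by (metis (no_types, lifting) LIM_zero_cancel Lim_transform_bound always_eventually)
  qed
  show "(\<lambda>N. hyp0F1 x (z + of_nat N)) \<longlonglongrightarrow> 1"
    using tendsto_of_nat by (intro translates) auto
  have "filterlim (\<lambda>N. - of_nat N :: complex) at_infinity sequentially"
    using filterlim_real_sequentially by (simp add: filterlim_at_infinity_conv_norm_at_top)
  then show "(\<lambda>N. hyp0F1 x (z - of_nat N)) \<longlonglongrightarrow> 1"
    using translates[of "\<lambda>N. - of_nat N"] by simp
qed

subsection \<open>The connection formula\<close>

definition bessel_part :: "real \<Rightarrow> real \<Rightarrow> complex \<Rightarrow> complex" where
  "bessel_part \<alpha> \<beta> s = scaled_Gamma \<alpha> s * hyp0F1 (of_real (\<alpha> * \<beta>)) (1 - s)"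

definition bessel_recurrence :: "real \<Rightarrow> (complex \<Rightarrow> complex) \<Rightarrow> bool" where
  "bessel_recurrence x y \<longleftrightarrow> (\<forall>s. s \<notin> \<int> \<longrightarrow> of_real x * (y (s + 1) - y (s - 1)) = s * y s)"

definition casorati :: "(complex \<Rightarrow> complex) \<Rightarrow> (complex \<Rightarrow> complex) \<Rightarrow> complex \<Rightarrow> complex" where
  "casorati y z s = y (s + 1) * z s - y s * z (s + 1)"

lemma bessel_recurrenceD: "bessel_recurrence x y \<Longrightarrow> s \<notin> \<int> \<Longrightarrow> of_real x * (y (s + 1) - y (s - 1)) = s * y s"
  by (simp add: bessel_recurrence_def)

lemma Gamma_nonzero_of_notin_Ints: "s \<notin> \<int> \<Longrightarrow> Gamma s \<noteq> 0"
  using nonpos_Ints_Int by (auto simp: Gamma_eq_zero_iff)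

lemma scaled_Gamma_nonzero: "\<alpha> > 0 \<Longrightarrow> s \<notin> \<int> \<Longrightarrow> scaled_Gamma \<alpha> s \<noteq> 0"
  by (simp add: scaled_Gamma_def Gamma_nonzero_of_notin_Ints)

lemma scaled_Gamma_plus1:
  assumes "\<alpha> > 0" "s \<notin> \<int>"
  shows "of_real \<alpha> * scaled_Gamma \<alpha> (s + 1) = s * scaled_Gamma \<alpha> s"
proof -
  have "s \<notin> \<int>\<^sub>\<le>\<^sub>0" using assms by auto
  then show ?thesis
    using assms by (simp add: scaled_Gamma_def Gamma_plus1 powr_diff)
qed

lemma scaled_Gamma_minus1:
  assumes "\<alpha> > 0" "s \<notin> \<int>"
  shows "scaled_Gamma \<alpha> (s - 1) = of_real \<alpha> * scaled_Gamma \<alpha> s / (s - 1)"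
proof -
  have "s - 1 \<noteq> 0" using assms(2) by auto
  then show ?thesis
    using scaled_Gamma_plus1[OF assms(1), of "s - 1"] assms(2) by (simp add: eq_divide_eq mult.commute)
qed

lemma bessel_recurrence_bessel_integral:
  assumes "x > 0"
  shows "bessel_recurrence x (bessel_integral x x)"
  using bessel_integral_recurrence[OF assms assms] by (simp add: bessel_recurrence_def algebra_simps)

lemma bessel_recurrence_bessel_part:
  assumes "x > 0"
  shows "bessel_recurrence x (bessel_part x x)"
  unfolding bessel_recurrence_def
proof (intro allI impI)
  fix s :: complex assume s: "s \<notin> \<int>"
  define X where "X = complex_of_real x"
  define H where "H = hyp0F1 (X\<^sup>2)"
  have part: "bessel_part x x z = scaled_Gamma x z * H (1 - z)" for z
    by (simp add: bessel_part_def H_def X_def power2_eq_square)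
  have nonzero: "s \<noteq> 0" "s - 1 \<noteq> 0" using s by auto
  have up: "X * scaled_Gamma x (s + 1) = s * scaled_Gamma x s"
    using assms s by (simp add: scaled_Gamma_plus1 X_def)
  have down: "X * scaled_Gamma x s / (s - 1) = scaled_Gamma x (s - 1)"
    using assms s by (simp add: scaled_Gamma_minus1 X_def)
  have "- s \<notin> \<int>\<^sub>\<le>\<^sub>0" using s by auto
  from hyp0F1_contiguous[OF this] have "H (- s) = H (1 - s) + X\<^sup>2 / (- s * (1 - s)) * H (2 - s)"
    by (simp add: H_def)
  also have "X\<^sup>2 / (- s * (1 - s)) = X\<^sup>2 / (s * (s - 1))"
    by (simp add: algebra_simps)
  finally have "X * bessel_part x x (s + 1) =
      s * scaled_Gamma x s * (H (1 - s) + X\<^sup>2 / (s * (s - 1)) * H (2 - s))"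
    by (simp add: part mult.assoc [symmetric] up)
  also have "\<dots> = s * bessel_part x x s + X * (X * scaled_Gamma x s / (s - 1)) * H (2 - s)"
    using nonzero by (simp add: part field_simps power2_eq_square)
  also have "X * (X * scaled_Gamma x s / (s - 1)) * H (2 - s) = X * bessel_part x x (s - 1)"
    unfolding down by (simp add: part)
  finally show "of_real x * (bessel_part x x (s + 1) - bessel_part x x (s - 1)) = s * bessel_part x x s"
    by (simp add: X_def right_diff_distrib)
qed

lemma bessel_recurrence_reflect:
  assumes "bessel_recurrence x y"
  shows "bessel_recurrence x (\<lambda>s. y (- s))"
  unfolding bessel_recurrence_def
proof (intro allI impI)
  fix s :: complex assume "s \<notin> \<int>"
  then have "of_real x * (y (- s + 1) - y (- s - 1)) = - s * y (- s)"
    by (intro bessel_recurrenceD[OF assms]) simp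
  moreover have "- (s + 1) = - s - 1" "- (s - 1) = - s + 1"
    by simp_all
  ultimately show "of_real x * (y (- (s + 1)) - y (- (s - 1))) = s * y (- s)"
    by (simp only:) algebra
qed

lemma casorati_plus1:
  assumes "bessel_recurrence x y" "bessel_recurrence x z" "x \<noteq> 0" "s \<notin> \<int>"
  shows "casorati y z (s + 1) = - casorati y z s"
proof -
  have "of_real x * (y (s + 1 + 1) - y s) = (s + 1) * y (s + 1)"
      "of_real x * (z (s + 1 + 1) - z s) = (s + 1) * z (s + 1)"
    using bessel_recurrenceD[OF assms(1), of "s + 1"] bessel_recurrenceD[OF assms(2), of "s + 1"] assms(4)
    by simp_all
  then have "of_real x * (casorati y z (s + 1) + casorati y z s) = 0"
    unfolding casorati_def by algebra
  then show ?thesis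
    using assms(3) by (simp add: add_eq_0_iff2)
qed

lemma mult_Gamma_Gamma_uminus_plus1:
  fixes s :: complex
  assumes "s \<notin> \<int>"
  shows "(s + 1) * Gamma (s + 1) * Gamma (- (s + 1)) = - (s * Gamma s * Gamma (- s))"
proof -
  have "- (s + 1) \<notin> \<int>\<^sub>\<le>\<^sub>0"
    using assms minus_in_Ints_iff[of "s + 1"] by auto
  from Gamma_plus1[OF this] have "Gamma (- s) = - (s + 1) * Gamma (- (s + 1))"
    by simp
  moreover have "Gamma (s + 1) = s * Gamma s"
    using assms by (intro Gamma_plus1) auto
  ultimately show ?thesis
    by algebra
qed

text \<open>Casorati determinants and $s\,\Gamma(s)\,\Gamma(-s)$ both change sign under $s \mapsto s + 1$, so
  their quotient equals its limit along $s + \mathbb{N}$.\<close>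

definition casorati_quotient :: "real \<Rightarrow> (complex \<Rightarrow> complex) \<Rightarrow> complex \<Rightarrow> complex" where
  "casorati_quotient x y s = casorati y (\<lambda>s. bessel_part x x (- s)) s / (s * Gamma s * Gamma (- s))"

lemma casorati_quotient_plus_of_nat:
  assumes "bessel_recurrence x y" "x > 0" "s \<notin> \<int>"
  shows "casorati_quotient x y (s + of_nat N) = casorati_quotient x y s"
proof (induction N)
  case (Suc N)
  define z where "z = s + of_nat N"
  have "z \<notin> \<int>"
    using assms(3) by (simp add: z_def)
  then have "casorati y (\<lambda>s. bessel_part x x (- s)) (z + 1) = - casorati y (\<lambda>s. bessel_part x x (- s)) z"
    using assms(1,2)
    by (intro casorati_plus1[of x] bessel_recurrence_reflect bessel_recurrence_bessel_part) auto
  then have "casorati_quotient x y (z + 1) = casorati_quotient x y z"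
    unfolding casorati_quotient_def mult_Gamma_Gamma_uminus_plus1[OF \<open>z \<notin> \<int>\<close>] by simp
  with Suc show ?case
    by (simp add: z_def add_ac)
qed simp

lemma casorati_quotient_eq:
  fixes y :: "complex \<Rightarrow> complex"
  assumes "x > 0" "s \<notin> \<int>"
  defines "H \<equiv> hyp0F1 (of_real (x\<^sup>2))" and "r \<equiv> (\<lambda>s. y s / scaled_Gamma x s)"
  shows "casorati_quotient x y s =
     r (s + 1) * H (1 + s) / of_real x + of_real x * r s * H (2 + s) * (1 / s) * (1 / (s + 1))"
proof -
  define X where "X = complex_of_real x"
  have "s + 1 \<notin> \<int>" using assms(2) by simp
  then have nonzero: "s \<noteq> 0" "s + 1 \<noteq> 0" "X \<noteq> 0" "Gamma s \<noteq> 0" "Gamma (- s) \<noteq> 0"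
    using assms(1,2) Ints_0 by (metis, metis, simp_all add: X_def Gamma_nonzero_of_notin_Ints)
  have y: "y z = r z * scaled_Gamma x z" if "z \<notin> \<int>" for z
    using scaled_Gamma_nonzero[OF assms(1) that] by (simp add: r_def)
  have up: "scaled_Gamma x (s + 1) = s * scaled_Gamma x s / X"
    using scaled_Gamma_plus1[OF assms(1,2)] nonzero by (simp add: X_def eq_divide_eq mult.commute)
  have down: "scaled_Gamma x (- s - 1) = - (X * scaled_Gamma x (- s) / (s + 1))"
    using scaled_Gamma_minus1[OF assms(1), of "- s"] assms(2)
      minus_divide_right[of "X * scaled_Gamma x (- s)" "s + 1"]
    by (simp add: X_def)
  have product: "scaled_Gamma x s * scaled_Gamma x (- s) = Gamma s * Gamma (- s)"
    using nonzero by (simp add: scaled_Gamma_def X_def powr_minus)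
  have "casorati y (\<lambda>s. bessel_part x x (- s)) s =
      y (s + 1) * (scaled_Gamma x (- s) * H (1 + s)) - y s * (scaled_Gamma x (- s - 1) * H (2 + s))"
    by (simp add: casorati_def bessel_part_def H_def power2_eq_square add.commute[of _ s])
  also have "\<dots> = scaled_Gamma x s * scaled_Gamma x (- s) *
      (r (s + 1) * s * H (1 + s) / X + r s * X * H (2 + s) / (s + 1))"
    unfolding y[OF assms(2)] y[OF \<open>s + 1 \<notin> \<int>\<close>] up down by (simp add: algebra_simps)
  also have "\<dots> = s * Gamma s * Gamma (- s) *
      (r (s + 1) * H (1 + s) / X + X * r s * H (2 + s) * (1 / s) * (1 / (s + 1)))"
    unfolding product using nonzero by (simp add: divide_simps)
  finally show ?thesis
    using nonzero by (simp add: casorati_quotient_def X_def)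
qed

lemma inverse_shift_tendsto_0: "(\<lambda>N. 1 / (s + of_nat N :: complex)) \<longlonglongrightarrow> 0"
  by (intro tendsto_divide_0[OF tendsto_const] tendsto_add_filterlim_at_infinity[OF tendsto_const]
      tendsto_of_nat)

lemma casorati_quotient_tendsto:
  assumes "x > 0" "s \<notin> \<int>"
    and lim: "(\<lambda>N. y (s + of_nat N) / scaled_Gamma x (s + of_nat N)) \<longlonglongrightarrow> l"
  shows "(\<lambda>N. casorati_quotient x y (s + of_nat N)) \<longlonglongrightarrow> l / of_real x"
proof -
  define r where "r z = y z / scaled_Gamma x z" for z
  define H where "H = hyp0F1 (of_real (x\<^sup>2))"
  have r_lim: "(\<lambda>N. r (s + of_nat N)) \<longlonglongrightarrow> l" "(\<lambda>N. r (s + of_nat N + 1)) \<longlonglongrightarrow> l"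
    using lim LIMSEQ_Suc[OF lim] by (simp_all add: r_def add_ac)
  have H_lim: "(\<lambda>N. H (1 + (s + of_nat N))) \<longlonglongrightarrow> 1" "(\<lambda>N. H (2 + (s + of_nat N))) \<longlonglongrightarrow> 1"
    using hyp0F1_tendsto_1(1)[of "1 + s"] hyp0F1_tendsto_1(1)[of "2 + s"] assms(2)
    by (simp_all add: H_def add.assoc)
  have inverse_lim: "(\<lambda>N. 1 / (s + of_nat N + 1)) \<longlonglongrightarrow> 0"
    using inverse_shift_tendsto_0[of "s + 1"] by (simp add: add_ac)
  have "casorati_quotient x y (s + of_nat N) = r (s + of_nat N + 1) * H (1 + (s + of_nat N)) / of_real x +
      of_real x * r (s + of_nat N) * H (2 + (s + of_nat N)) *
        (1 / (s + of_nat N)) * (1 / (s + of_nat N + 1))" for N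
    unfolding r_def H_def using assms(1,2) by (intro casorati_quotient_eq) auto
  moreover have "(\<lambda>N. r (s + of_nat N + 1) * H (1 + (s + of_nat N)) / of_real x +
      of_real x * r (s + of_nat N) * H (2 + (s + of_nat N)) *
        (1 / (s + of_nat N)) * (1 / (s + of_nat N + 1)))
    \<longlonglongrightarrow> l * 1 / of_real x + of_real x * l * 1 * 0 * 0"
    using assms(1) by (intro tendsto_intros r_lim H_lim inverse_lim inverse_shift_tendsto_0) auto
  ultimately show ?thesis
    by simp
qed

lemma casorati_quotient_eq_limit:
  assumes "bessel_recurrence x y" "x > 0" "s \<notin> \<int>"
    and "(\<lambda>N. y (s + of_nat N) / scaled_Gamma x (s + of_nat N)) \<longlonglongrightarrow> l"
  shows "casorati_quotient x y s = l / of_real x"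
  using casorati_quotient_tendsto[OF assms(2-4)]
  by (simp add: casorati_quotient_plus_of_nat[OF assms(1-3)] LIMSEQ_const_iff)

lemma casorati_eq_0_iff_quotient:
  assumes "s \<notin> \<int>"
  shows "casorati y (\<lambda>s. bessel_part x x (- s)) s = 0 \<longleftrightarrow> casorati_quotient x y s = 0"
  using assms Gamma_nonzero_of_notin_Ints[of s] Gamma_nonzero_of_notin_Ints[of "- s"]
  by (auto simp: casorati_quotient_def)

lemma Gamma_Re_over_norm_Gamma_tendsto_1:
  assumes "Re s > 0"
  shows "(\<lambda>N. Gamma (Re s + of_nat (Suc N)) / norm (Gamma (s + of_nat (Suc N)))) \<longlonglongrightarrow> 1"
proof -
  define \<sigma> where "\<sigma> = Re s"
  have not_pole: "s \<notin> \<int>\<^sub>\<le>\<^sub>0" "\<sigma> \<notin> \<int>\<^sub>\<le>\<^sub>0"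
    using assms by (auto simp: \<sigma>_def elim!: nonpos_Ints_cases)
  then have Gamma_nonzero: "Gamma s \<noteq> 0" "Gamma \<sigma> \<noteq> 0"
    by (simp_all add: Gamma_eq_zero_iff)
  have "(\<lambda>N. (norm (Gamma_series s N) / Gamma_series \<sigma> N) * (Gamma \<sigma> / norm (Gamma s)))
      \<longlonglongrightarrow> (norm (Gamma s) / Gamma \<sigma>) * (Gamma \<sigma> / norm (Gamma s))"
    using Gamma_nonzero by (intro tendsto_intros Gamma_series_LIMSEQ)
  moreover have "(norm (Gamma_series s N) / Gamma_series \<sigma> N) * (Gamma \<sigma> / norm (Gamma s)) =
      Gamma (\<sigma> + of_nat (Suc N)) / norm (Gamma (s + of_nat (Suc N)))" for N
  proof -
    have "norm (Gamma_series s N) / Gamma_series \<sigma> N = pochhammer \<sigma> (Suc N) / norm (pochhammer s (Suc N))"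
      by (simp add: Gamma_series_def norm_divide norm_mult \<sigma>_def del: pochhammer_Suc)
    then show ?thesis
      unfolding pochhammer_Gamma[OF not_pole(1)] pochhammer_Gamma[OF not_pole(2)]
      using Gamma_nonzero by (simp add: norm_divide del: of_nat_Suc)
  qed
  ultimately show ?thesis
    using Gamma_nonzero by (simp add: \<sigma>_def)
qed

lemma norm_bessel_integral_over_scaled_Gamma_minus_1_le:
  assumes "\<alpha> > 0" "\<beta> > 0" "s \<notin> \<int>" "Re s > 1"
  shows "norm (bessel_integral \<alpha> \<beta> s / scaled_Gamma \<alpha> s - 1)
    \<le> \<alpha> * \<beta> / (Re s - 1) * (Gamma (Re s) / norm (Gamma s))"
proof -
  have "norm (bessel_integral \<alpha> \<beta> s / scaled_Gamma \<alpha> s - 1) =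
      norm (bessel_integral \<alpha> \<beta> s - scaled_Gamma \<alpha> s) / norm (scaled_Gamma \<alpha> s)"
    using scaled_Gamma_nonzero[OF assms(1,3)] by (simp add: norm_divide [symmetric] diff_divide_distrib)
  also have "\<dots> \<le> \<beta> * (Gamma (Re s - 1) * \<alpha> powr (1 - Re s)) / norm (scaled_Gamma \<alpha> s)"
    using assms by (intro divide_right_mono norm_bessel_integral_minus_scaled_Gamma_le) auto
  also have "norm (scaled_Gamma \<alpha> s) = norm (Gamma s) * \<alpha> powr (- Re s)"
    using assms(1) by (simp add: scaled_Gamma_def norm_mult norm_powr_real_powr)
  also have "\<alpha> powr (1 - Re s) = \<alpha> * \<alpha> powr (- Re s)"
    using assms(1) powr_add[of \<alpha> 1 "- Re s"] by simp
  also have "Gamma (Re s - 1) = Gamma (Re s) / (Re s - 1)"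
  proof -
    have "Re s - 1 \<notin> \<int>\<^sub>\<le>\<^sub>0" using assms(4) nonpos_Ints_nonpos by fastforce
    from Gamma_plus1[OF this] show ?thesis using assms(4) by (simp add: field_simps)
  qed
  finally show ?thesis
    using assms(1) by (simp add: mult_ac)
qed

lemma bessel_integral_over_scaled_Gamma_tendsto_1:
  assumes "\<alpha> > 0" "\<beta> > 0" "s \<notin> \<int>"
  shows "(\<lambda>N. bessel_integral \<alpha> \<beta> (s + of_nat N) / scaled_Gamma \<alpha> (s + of_nat N)) \<longlonglongrightarrow> 1"
proof -
  obtain M :: nat where "- Re s < real M"
    using reals_Archimedean2 by blast
  define z where "z N = s + of_nat M + of_nat (Suc N)" for N
  have z: "z N \<notin> \<int>" "Re (z N) - 1 = Re s + real M + real N" "Re (z N) > 1" for N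
    using assms(3) \<open>- Re s < real M\<close> by (simp_all add: z_def add_ac)
  have "(\<lambda>N. \<alpha> * \<beta> / (Re s + real M + real N)) \<longlonglongrightarrow> 0"
    by real_asymp
  from tendsto_mult[OF this Gamma_Re_over_norm_Gamma_tendsto_1[of "s + of_nat M"]]
  have "(\<lambda>N. \<alpha> * \<beta> / (Re (z N) - 1) * (Gamma (Re (z N)) / norm (Gamma (z N)))) \<longlonglongrightarrow> 0"
    using \<open>- Re s < real M\<close> unfolding z by (simp add: z_def)
  then have "(\<lambda>N. bessel_integral \<alpha> \<beta> (z N) / scaled_Gamma \<alpha> (z N) - 1) \<longlonglongrightarrow> 0"
    by (rule Lim_null_comparison[rotated])
       (intro always_eventually allI
          norm_bessel_integral_over_scaled_Gamma_minus_1_le[OF assms(1,2) z(1,3)])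
  then have "(\<lambda>N. bessel_integral \<alpha> \<beta> (s + of_nat (N + Suc M)) /
      scaled_Gamma \<alpha> (s + of_nat (N + Suc M))) \<longlonglongrightarrow> 1"
    by (simp add: LIM_zero_iff z_def add_ac)
  then show ?thesis
    by (rule LIMSEQ_offset)
qed

lemma bessel_part_over_scaled_Gamma_tendsto_1:
  assumes "\<alpha> > 0" "s \<notin> \<int>"
  shows "(\<lambda>N. bessel_part \<alpha> \<beta> (s + of_nat N) / scaled_Gamma \<alpha> (s + of_nat N)) \<longlonglongrightarrow> 1"
proof -
  have "bessel_part \<alpha> \<beta> (s + of_nat N) / scaled_Gamma \<alpha> (s + of_nat N) =
      hyp0F1 (of_real (\<alpha> * \<beta>)) (1 - s - of_nat N)" for N
    using scaled_Gamma_nonzero[OF assms(1), of "s + of_nat N"] assms(2)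
    by (simp add: bessel_part_def algebra_simps)
  then show ?thesis
    using hyp0F1_tendsto_1(2)[of "1 - s"] assms(2) by simp
qed

text \<open>The difference \<open>D\<close> of the two sides is a multiple of the reflected part, as it is negligible against
  $\Gamma$ along $s + \mathbb{N}$. Being even, it is also a multiple of the part itself, which is
  independent of the reflected part.\<close>

lemma bessel_integral_diagonal_eq_sum:
  assumes "x > 0" "s \<notin> \<int>"
  shows "bessel_integral x x s = bessel_part x x s + bessel_part x x (- s)"
proof -
  define part where "part = bessel_part x x"
  define reflected where "reflected s = part (- s)" for s
  define D where "D s = bessel_integral x x s - part s - reflected s" for s
  have quotient: "casorati_quotient x (bessel_integral x x) z = 1 / of_real x"
      "casorati_quotient x part z = 1 / of_real x" if "z \<notin> \<int>" for z
    unfolding part_def using assms(1) that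
    by (intro casorati_quotient_eq_limit bessel_recurrence_bessel_integral bessel_recurrence_bessel_part
        bessel_integral_over_scaled_Gamma_tendsto_1 bessel_part_over_scaled_Gamma_tendsto_1; simp)+
  have casorati_D: "casorati D reflected z = 0" if "z \<notin> \<int>" for z
  proof -
    have "casorati_quotient x D z =
        casorati_quotient x (bessel_integral x x) z - casorati_quotient x part z"
      by (simp add: casorati_quotient_def casorati_def D_def reflected_def part_def
          ring_distribs diff_divide_distrib [symmetric])
    then show ?thesis
      using quotient[OF that] casorati_eq_0_iff_quotient[OF that, of D x]
      by (simp add: reflected_def [abs_def] part_def)
  qed
  have D_even: "D (- z) = D z" for z
    using bessel_integral_swap[of x x z] by (simp add: D_def reflected_def)
  have "D (s + 1) * reflected s = D s * reflected (s + 1)"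
    using casorati_D[OF assms(2)] by (simp add: casorati_def)
  moreover have "D s * part (s + 1) = D (s + 1) * part s"
    using casorati_D[of "- (s + 1)"] assms(2) D_even[of s] D_even[of "s + 1"]
    by (simp add: casorati_def reflected_def add.commute)
  ultimately have "D s * casorati part reflected s = 0"
    unfolding casorati_def by algebra
  then have "D s = 0"
    using quotient(2)[OF assms(2)] casorati_eq_0_iff_quotient[OF assms(2), of part x] assms(1)
    by (auto simp: reflected_def [abs_def] part_def)
  then show ?thesis
    by (simp add: D_def reflected_def part_def diff_eq_eq add.commute)
qed

lemma bessel_part_scale:
  assumes "c > 0" "\<alpha> > 0"
  shows "bessel_part \<alpha> \<beta> s = of_real c powr s * bessel_part (\<alpha> * c) (\<beta> / c) s"
  using assms by (simp add: bessel_part_def scaled_Gamma_def powr_times_real powr_minus mult_ac)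

theorem bessel_integral_eq_sum:
  assumes "\<alpha> > 0" "\<beta> > 0" "s \<notin> \<int>"
  shows "bessel_integral \<alpha> \<beta> s = bessel_part \<alpha> \<beta> s + bessel_part \<beta> \<alpha> (- s)"
proof -
  define c where "c = sqrt (\<beta> / \<alpha>)"
  define x where "x = sqrt (\<alpha> * \<beta>)"
  have pos: "c > 0" "x > 0" using assms by (simp_all add: c_def x_def)
  have balance: "\<alpha> * c = x" "\<beta> / c = x" "\<beta> * (1 / c) = x" "\<alpha> / (1 / c) = x"
    using assms by (simp_all add: c_def x_def real_sqrt_mult real_sqrt_divide field_simps)
  have "bessel_part \<beta> \<alpha> (- s) = of_real (1 / c) powr (- s) * bessel_part x x (- s)"
    using bessel_part_scale[of "1 / c" \<beta> \<alpha> "- s"] assms pos by (simp only: balance) simp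
  also have "complex_of_real (1 / c) powr (- s) = of_real c powr s"
    using pos by (simp add: powr_def Ln_of_real ln_div flip: of_real_divide)
  finally show ?thesis
    using bessel_part_scale[of c \<alpha> \<beta> s] bessel_integral_scale[of c \<alpha> \<beta> s]
      bessel_integral_diagonal_eq_sum[OF pos(2) assms(3)] assms pos
    by (simp add: balance distrib_left)
qed

definition bessel_reduced_part :: "nat \<Rightarrow> real \<Rightarrow> real \<Rightarrow> complex \<Rightarrow> complex" where
  "bessel_reduced_part k \<alpha> \<beta> s =
     of_real \<alpha> powr (of_nat k - s) * of_real \<beta> ^ k * hyp0F1_tail k (of_real (\<alpha> * \<beta>)) (1 - s + of_nat k)"

lemma bessel_part_eq_partial_sum_plus_reduced_part:
  assumes "\<alpha> > 0" "s \<notin> \<int>"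
  shows "bessel_part \<alpha> \<beta> s = Gamma s *
    ((\<Sum>j<k. 1 / (fact j * pochhammer (1 - s) j) * (of_real \<alpha> powr (of_nat j - s) * of_real \<beta> ^ j)) +
     1 / pochhammer (1 - s) k * bessel_reduced_part k \<alpha> \<beta> s)"
proof -
  have "1 - s \<notin> \<int>\<^sub>\<le>\<^sub>0" using assms(2) by auto
  moreover have "of_real \<alpha> powr (of_nat j - s) = of_real \<alpha> powr (- s) * of_real \<alpha> ^ j" for j
    using assms(1) powr_add[of "complex_of_real \<alpha>" "- s" "of_nat j"] by simp
  ultimately show ?thesis
    by (simp add: bessel_part_def scaled_Gamma_def hyp0F1_eq_partial_sum_plus_tail[of "1 - s" _ k]
        bessel_reduced_part_def distrib_left sum_distrib_left power_mult_distrib mult_ac)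
qed

lemma cnj_bessel_part:
  assumes "\<alpha> > 0" "s \<notin> \<int>"
  shows "cnj (bessel_part \<alpha> \<beta> s) = bessel_part \<alpha> \<beta> (cnj s)"
proof -
  have "1 - s \<notin> \<int>\<^sub>\<le>\<^sub>0" using assms(2) by auto
  then show ?thesis
    using assms(1) by (simp add: bessel_part_def scaled_Gamma_def cnj_hyp0F1_tail cnj_Gamma cnj_powr)
qed

subsection \<open>Exponential sums\<close>

definition exp_sum :: "'i set \<Rightarrow> ('i \<Rightarrow> complex) \<Rightarrow> ('i \<Rightarrow> real) \<Rightarrow> complex \<Rightarrow> complex" where
  "exp_sum I c l z = (\<Sum>i\<in>I. c i * exp (of_real (l i) * z))"

lemma exp_sum_holomorphic: "exp_sum I c l holomorphic_on A"
  unfolding exp_sum_def [abs_def] by (intro holomorphic_intros)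

lemma exp_sum_dominant_tendsto:
  assumes "finite I" "k \<in> I" "\<And>i. i \<in> I - {k} \<Longrightarrow> l i < l k"
  shows "((\<lambda>x. exp_sum I c l (of_real x) * exp (- of_real (x * l k))) \<longlongrightarrow> c k) at_top"
proof -
  have "((\<lambda>x. \<Sum>i\<in>I. c i * of_real (exp (x * (l i - l k)))) \<longlongrightarrow> (\<Sum>i\<in>I. if i = k then c k else 0)) at_top"
  proof (rule tendsto_sum)
    fix i assume "i \<in> I"
    show "((\<lambda>x. c i * of_real (exp (x * (l i - l k)))) \<longlongrightarrow> (if i = k then c k else 0)) at_top"
    proof (cases "i = k")
      case False
      then have "l i - l k < 0"
        using assms(3)[of i] \<open>i \<in> I\<close> by simp
      then have "((\<lambda>x. exp (x * (l i - l k))) \<longlongrightarrow> 0) at_top"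
        by real_asymp
      from tendsto_mult[OF tendsto_const[of "c i"] tendsto_of_real[OF this]] show ?thesis
        using False by simp
    qed simp
  qed
  moreover have "(\<Sum>i\<in>I. c i * of_real (exp (x * (l i - l k)))) =
      exp_sum I c l (of_real x) * exp (- of_real (x * l k))" for x
    unfolding exp_sum_def sum_distrib_right
    by (intro sum.cong refl) (simp add: exp_of_real [symmetric] right_diff_distrib exp_diff
        exp_minus divide_inverse mult_ac)
  ultimately show ?thesis
    using assms(1,2) by simp
qed

lemma exp_sum_not_identically_0:
  assumes "finite I" "inj_on l I" "\<exists>i\<in>I. c i \<noteq> 0" "open S" "S \<noteq> {}"
  shows "\<exists>z\<in>S. exp_sum I c l z \<noteq> 0"
proof (rule ccontr)
  assume vanishing: "\<not> ?thesis"
  define J where "J = {i \<in> I. c i \<noteq> 0}"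
  have J: "finite J" "J \<noteq> {}" "J \<subseteq> I"
    using assms by (auto simp: J_def)
  have "exp_sum I c l z = 0" for z
    by (rule analytic_continuation_open[OF assms(4) open_UNIV assms(5), where g = "\<lambda>_. 0"])
       (use vanishing in \<open>auto intro: exp_sum_holomorphic\<close>)
  moreover have "exp_sum J c l z = exp_sum I c l z" for z
    unfolding exp_sum_def using assms(1) by (intro sum.mono_neutral_left) (auto simp: J_def)
  ultimately have zero: "exp_sum J c l z = 0" for z
    by simp
  have "Max (l ` J) \<in> l ` J"
    using J by (intro Max_in) auto
  then obtain k where k: "k \<in> J" "l k = Max (l ` J)"
    by auto
  then have "l i < l k" if "i \<in> J - {k}" for i
    using that J(1,3) inj_onD[OF assms(2), of i k] by (force simp: order_less_le)
  then have "((\<lambda>x. exp_sum J c l (of_real x) * exp (- of_real (x * l k))) \<longlongrightarrow> c k) at_top"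
    using J(1) k(1) by (intro exp_sum_dominant_tendsto)
  then have "c k = 0"
    by (simp add: zero tendsto_const_iff)
  then show False
    using k(1) by (simp add: J_def)
qed

lemma uniform_limit_sum:
  fixes f :: "'i \<Rightarrow> 'a \<Rightarrow> 'b \<Rightarrow> 'c :: real_normed_vector"
  assumes "finite I" "\<And>i. i \<in> I \<Longrightarrow> uniform_limit X (f i) (g i) F"
  shows "uniform_limit X (\<lambda>n x. \<Sum>i\<in>I. f i n x) (\<lambda>x. \<Sum>i\<in>I. g i x) F"
  using assms
  by (induction I rule: finite_induct) (auto intro!: uniform_limit_add uniform_limit_const)

lemma uniform_limit_exp_sum:
  assumes "finite I" "\<And>i. i \<in> I \<Longrightarrow> (\<lambda>j. d j i) \<longlonglongrightarrow> c i" "compact K"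
  shows "uniform_limit K (\<lambda>j. exp_sum I (d j) l) (exp_sum I c l) sequentially"
  unfolding exp_sum_def [abs_def]
proof (rule uniform_limit_sum[OF assms(1)])
  fix i assume "i \<in> I"
  have coefficient: "uniform_limit K (\<lambda>j z. d j i) (\<lambda>z. c i) sequentially"
    using assms(2)[OF \<open>i \<in> I\<close>] by (auto simp: uniform_limit_iff tendsto_iff elim!: eventually_mono)
  have "bounded ((\<lambda>z. exp (of_real (l i) * z)) ` K)"
    using assms(3) by (intro compact_imp_bounded compact_continuous_image continuous_intros)
  then show "uniform_limit K (\<lambda>j z. d j i * exp (of_real (l i) * z))
      (\<lambda>z. c i * exp (of_real (l i) * z)) sequentially"
    by (intro uniform_lim_mult[OF coefficient uniform_limit_const]) (auto simp: bounded_iff)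
qed

lemma exp_sum_limit_nonzero:
  assumes "finite I" "inj_on l I" "\<exists>i\<in>I. c i \<noteq> 0"
    and "open S" "connected S" "z \<in> S"
    and coefficients: "\<And>i. i \<in> I \<Longrightarrow> (\<lambda>j. d j i) \<longlonglongrightarrow> c i"
    and nonzero: "\<And>j z. z \<in> S \<Longrightarrow> exp_sum I (d j) l z \<noteq> 0"
  shows "exp_sum I c l z \<noteq> 0"
proof (cases "exp_sum I c l constant_on S")
  case True
  then show ?thesis
    using exp_sum_not_identically_0[OF assms(1-4)] \<open>z \<in> S\<close> by (metis constant_on_def empty_iff)
next
  case False
  have "uniform_limit K (\<lambda>j. exp_sum I (d j) l) (exp_sum I c l) sequentially" if "compact K" for K
    using assms(1) coefficients that by (rule uniform_limit_exp_sum)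
  then show ?thesis
    using False assms(4-6) nonzero
    by (intro Hurwitz_no_zeros[of S "\<lambda>j. exp_sum I (d j) l" "exp_sum I c l"])
       (auto intro: exp_sum_holomorphic)
qed

lemma compact_PiE_UNIV:
  assumes "\<And>i. compact (A i)"
  shows "compact (PiE UNIV A)"
  using assms compactin_PiE[of "\<lambda>_. euclidean" UNIV A] by (simp add: euclidean_product_topology)

lemma phases_convergent_subseq:
  fixes l :: "'i :: countable \<Rightarrow> real" and s :: "nat \<Rightarrow> complex"
  assumes "\<And>j. u \<le> Re (s j)" "\<And>j. Re (s j) \<le> v"
  obtains \<omega> \<rho> r where "strict_mono r" "u \<le> \<rho>" "\<rho> \<le> v" "\<And>i. \<omega> i \<noteq> (0 :: complex)"
    "(\<lambda>j. Re (s (r j))) \<longlonglongrightarrow> \<rho>" "\<And>i. (\<lambda>j. exp (\<i> * of_real (l i * Im (s (r j))))) \<longlonglongrightarrow> \<omega> i"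
proof -
  define phase where "phase j i = exp (\<i> * of_real (l i * Im (s j)))" for j i
  define domain where "domain = PiE UNIV (\<lambda>_ :: 'i. sphere (0 :: complex) 1) \<times> {u..v}"
  have "(phase j, Re (s j)) \<in> domain" for j
    using assms by (simp add: domain_def phase_def PiE_iff)
  moreover have compact_domain: "compact domain"
    unfolding domain_def by (intro compact_Times compact_PiE_UNIV) auto
  ultimately obtain L r where "L \<in> domain" and r: "strict_mono r" "((\<lambda>j. (phase j, Re (s j))) \<circ> r) \<longlonglongrightarrow> L"
    using compact_domain[unfolded compact_def, rule_format, of "\<lambda>j. (phase j, Re (s j))"] by blast
  moreover obtain \<omega> \<rho> where L: "L = (\<omega>, \<rho>)"
    by fastforce
  ultimately have limits: "u \<le> \<rho>" "\<rho> \<le> v" "norm (\<omega> i) = 1" for i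
    by (simp_all add: domain_def PiE_iff)
  have phase_lim: "(\<lambda>j. phase (r j) i) \<longlonglongrightarrow> \<omega> i" for i
  proof -
    have "isCont (\<lambda>x :: 'i \<Rightarrow> complex. x i) \<omega>"
      by (rule continuous_on_interior[OF continuous_on_product_coordinates]) simp
    moreover have "(\<lambda>j. phase (r j)) \<longlonglongrightarrow> \<omega>"
      using tendsto_fst[OF r(2)] by (simp add: L o_def)
    ultimately show ?thesis
      by (rule isCont_tendsto_compose)
  qed
  have Re_lim: "(\<lambda>j. Re (s (r j))) \<longlonglongrightarrow> \<rho>"
    using tendsto_snd[OF r(2)] by (simp add: L o_def)
  have "\<omega> i \<noteq> 0" for i
    using limits(3)[of i] by auto
  from that[OF r(1) limits(1,2) this Re_lim phase_lim[unfolded phase_def]] show ?thesis .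
qed

lemma open_vertical_strip: "open {z. u < Re z \<and> Re z < v}"
  using open_Int[OF open_halfspace_Re_gt[of u] open_halfspace_Re_lt[of v]] by (simp add: Collect_conj_eq)

lemma connected_vertical_strip: "connected {z. u < Re z \<and> Re z < v}"
  using convex_connected[OF convex_Int[OF convex_halfspace_Re_gt[of u] convex_halfspace_Re_lt[of v]]]
  by (simp add: Collect_conj_eq)

lemma exp_sum_translate:
  "exp_sum I (\<lambda>i. c i * exp (\<i> * of_real (l i * y))) l z = exp_sum I c l (z + \<i> * of_real y)"
  by (simp add: exp_sum_def distrib_left exp_add mult_ac)

text \<open>Along a sequence of points at which the sum tends to $0$, the vertical translates of the sum have a
  limit of the same shape, because their coefficients differ from the original ones by phases only.\<close>

lemma exp_sum_not_tendsto_0: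
  fixes c :: "'i :: countable \<Rightarrow> complex"
  assumes "finite I" "inj_on l I" "\<exists>i\<in>I. c i \<noteq> 0"
    and nonzero: "\<And>z. u < Re z \<Longrightarrow> Re z < v \<Longrightarrow> exp_sum I c l z \<noteq> 0"
    and "u < u'" "v' < v"
    and s: "\<And>j. u' \<le> Re (s j)" "\<And>j. Re (s j) \<le> v'"
  shows "\<not> (\<lambda>j. exp_sum I c l (s j)) \<longlonglongrightarrow> 0"
proof
  assume null: "(\<lambda>j. exp_sum I c l (s j)) \<longlonglongrightarrow> 0"
  from phases_convergent_subseq[of u' s v' l, OF s] obtain \<omega> \<rho> r where
    r: "strict_mono r" and \<rho>: "u' \<le> \<rho>" "\<rho> \<le> v'" "(\<lambda>j. Re (s (r j))) \<longlonglongrightarrow> \<rho>" and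
    \<omega>: "\<And>i. \<omega> i \<noteq> 0" "\<And>i. (\<lambda>j. exp (\<i> * of_real (l i * Im (s (r j))))) \<longlonglongrightarrow> \<omega> i"
    by metis
  define d where "d j i = c i * exp (\<i> * of_real (l i * Im (s (r j))))" for j i
  have d_lim: "(\<lambda>j. d j i) \<longlonglongrightarrow> c i * \<omega> i" for i
    unfolding d_def by (intro tendsto_intros \<omega>)
  have translate: "exp_sum I (d j) l z = exp_sum I c l (z + \<i> * of_real (Im (s (r j))))" for j z
    unfolding d_def [abs_def] by (rule exp_sum_translate)
  have "exp_sum I (\<lambda>i. c i * \<omega> i) l (of_real \<rho>) \<noteq> 0"
  proof (rule exp_sum_limit_nonzero[OF assms(1,2), where d = d])
    show "\<exists>i\<in>I. c i * \<omega> i \<noteq> 0"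
      using assms(3) \<omega>(1) by simp
    show "of_real \<rho> \<in> {z. u < Re z \<and> Re z < v}"
      using \<rho>(1,2) \<open>u < u'\<close> \<open>v' < v\<close> by simp
    show "exp_sum I (d j) l z \<noteq> 0" if "z \<in> {z. u < Re z \<and> Re z < v}" for j z
      unfolding translate using that by (intro nonzero) auto
  qed (rule open_vertical_strip connected_vertical_strip d_lim)+
  moreover have "(\<lambda>j. exp_sum I (d j) l (of_real (Re (s (r j))))) \<longlonglongrightarrow> exp_sum I (\<lambda>i. c i * \<omega> i) l (of_real \<rho>)"
    unfolding exp_sum_def by (intro tendsto_intros d_lim \<rho>)
  moreover have "(\<lambda>j. exp_sum I (d j) l (of_real (Re (s (r j))))) \<longlonglongrightarrow> 0"
    using LIMSEQ_subseq_LIMSEQ[OF null r] unfolding translate by (simp add: o_def complex_eq [symmetric])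
  ultimately show False
    using LIMSEQ_unique by blast
qed

lemma exp_sum_bounded_below:
  fixes c :: "'i :: countable \<Rightarrow> complex"
  assumes "finite I" "inj_on l I" "\<exists>i\<in>I. c i \<noteq> 0"
    and "\<And>z. u < Re z \<Longrightarrow> Re z < v \<Longrightarrow> exp_sum I c l z \<noteq> 0"
    and "u < u'" "v' < v"
  shows "\<exists>e>0. \<forall>z. u' \<le> Re z \<longrightarrow> Re z \<le> v' \<longrightarrow> e \<le> norm (exp_sum I c l z)"
proof (rule ccontr)
  assume no_bound: "\<not> ?thesis"
  have "\<exists>z. u' \<le> Re z \<and> Re z \<le> v' \<and> norm (exp_sum I c l z) < inverse (real (Suc j))" for j
    using no_bound by (metis inverse_positive_iff_positive not_le of_nat_0_less_iff zero_less_Suc)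
  then obtain s where s: "\<And>j. u' \<le> Re (s j)" "\<And>j. Re (s j) \<le> v'"
    "\<And>j. norm (exp_sum I c l (s j)) < inverse (real (Suc j))"
    by metis
  have "(\<lambda>j. exp_sum I c l (s j)) \<longlonglongrightarrow> 0"
    using s(3)
    by (intro Lim_null_comparison[OF _ LIMSEQ_inverse_real_of_nat] always_eventually)
       (auto intro: less_imp_le)
  then show False
    using exp_sum_not_tendsto_0[where s = s, OF assms(1-3) _ assms(5,6) s(1,2)] assms(4) by blast
qed

subsection \<open>The ends of a vertical strip\<close>

definition strip_ends :: "real \<Rightarrow> complex filter" where
  "strip_ends R = inf (filtercomap (\<lambda>s. \<bar>Im s\<bar>) at_top) (principal {s. \<bar>Re s\<bar> \<le> R})"

lemma eventually_strip_ends: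
  "eventually P (strip_ends R) \<longleftrightarrow> (\<exists>T. \<forall>s. \<bar>Re s\<bar> \<le> R \<longrightarrow> T \<le> \<bar>Im s\<bar> \<longrightarrow> P s)"
  unfolding strip_ends_def eventually_inf_principal eventually_filtercomap_at_top_linorder by auto

lemma strip_ends_le_at_infinity: "strip_ends R \<le> at_infinity"
proof (rule filter_leI)
  fix P :: "complex \<Rightarrow> bool" assume "eventually P at_infinity"
  then obtain b where "\<And>s. b \<le> norm s \<Longrightarrow> P s"
    by (auto simp: eventually_at_infinity)
  then show "eventually P (strip_ends R)"
    unfolding eventually_strip_ends using abs_Im_le_cmod order_trans by blast
qed

lemma eventually_Im_gt_strip_ends: "eventually (\<lambda>s. T < \<bar>Im s\<bar>) (strip_ends R)"
  unfolding eventually_strip_ends by (intro exI[of _ "T + 1"]) auto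

lemma eventually_Re_le_strip_ends: "eventually (\<lambda>s. \<bar>Re s\<bar> \<le> R) (strip_ends R)"
  unfolding eventually_strip_ends by blast

lemma filterlim_strip_ends:
  assumes "\<And>s. \<bar>Re s\<bar> \<le> R \<Longrightarrow> \<bar>Re (f s)\<bar> \<le> R'" "\<And>s. \<bar>Im (f s)\<bar> = \<bar>Im s\<bar>"
  shows "filterlim f (strip_ends R') (strip_ends R)"
  unfolding filterlim_iff eventually_strip_ends using assms by metis

lemma strip_ends_mono: "R \<le> R' \<Longrightarrow> strip_ends R \<le> strip_ends R'"
  unfolding strip_ends_def by (intro inf_mono order_refl) auto

lemma deriv_bigo_strip_ends:
  assumes "R < R'" "h \<in> O[strip_ends R'](\<lambda>_. 1)"
    and "eventually (\<lambda>s. h field_differentiable at s) (strip_ends R')"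
  shows "deriv h \<in> O[strip_ends R](\<lambda>_. 1)"
proof -
  obtain B where "eventually (\<lambda>s. norm (h s) \<le> B) (strip_ends R')"
    using assms(2) by (auto elim!: landau_o.bigE)
  from eventually_conj[OF this assms(3)] obtain T where
    T: "\<And>s. \<bar>Re s\<bar> \<le> R' \<Longrightarrow> T \<le> \<bar>Im s\<bar> \<Longrightarrow> norm (h s) \<le> B \<and> h field_differentiable at s"
    unfolding eventually_strip_ends by blast
  define r where "r = R' - R"
  have r: "r > 0" using assms(1) by (simp add: r_def)
  have "norm (deriv h s) \<le> B / r" if s: "\<bar>Re s\<bar> \<le> R" "T + r \<le> \<bar>Im s\<bar>" for s
  proof -
    have near: "norm (h w) \<le> B \<and> h field_differentiable at w" if "w \<in> cball s r" for w
    proof (rule T)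
      have "\<bar>Re s - Re w\<bar> \<le> r" "\<bar>Im s - Im w\<bar> \<le> r"
        using abs_Re_le_cmod[of "s - w"] abs_Im_le_cmod[of "s - w"] that by (simp_all add: dist_norm)
      then show "\<bar>Re w\<bar> \<le> R'" "T \<le> \<bar>Im w\<bar>"
        using s unfolding r_def by linarith+
    qed
    then have "h holomorphic_on cball s r"
      by (simp add: holomorphic_on_def field_differentiable_at_within)
    then have "norm ((deriv ^^ 1) h s) \<le> fact 1 * B / r ^ 1"
      using near r by (intro Cauchy_inequality)
        (auto intro: holomorphic_on_imp_continuous_on holomorphic_on_subset simp: dist_norm)
    then show ?thesis by simp
  qed
  then have "eventually (\<lambda>s. norm (deriv h s) \<le> B / r * norm (1 :: complex)) (strip_ends R)"
    unfolding eventually_strip_ends by auto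
  then show ?thesis by (rule bigoI)
qed

lemma logderiv_bigo_strip_ends:
  assumes "R < R'" "h \<in> O[strip_ends R'](\<lambda>_. 1)"
    and "eventually (\<lambda>s. h field_differentiable at s) (strip_ends R')"
    and "e > 0" "eventually (\<lambda>s. e \<le> norm (h s)) (strip_ends R)"
  shows "(\<lambda>s. deriv h s / h s) \<in> O[strip_ends R](\<lambda>_. 1)"
proof -
  have "eventually (\<lambda>s. norm (inverse (h s)) \<le> inverse e * norm (1 :: complex)) (strip_ends R)"
    using assms(5) by eventually_elim (use assms(4) in \<open>simp add: norm_inverse le_imp_inverse_le\<close>)
  then have "(\<lambda>s. inverse (h s)) \<in> O[strip_ends R](\<lambda>_. 1)"
    by (rule bigoI)
  from landau_o.big.mult[OF deriv_bigo_strip_ends[OF assms(1-3)] this] show ?thesis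
    by (simp add: divide_inverse)
qed

lemma powr_bigo_strip_ends:
  assumes "\<alpha> > 0"
  shows "(\<lambda>s. of_real \<alpha> powr s) \<in> O[strip_ends R](\<lambda>_. 1)"
proof (rule bigoI)
  show "eventually (\<lambda>s. norm (of_real \<alpha> powr s) \<le> exp (R * \<bar>ln \<alpha>\<bar>) * norm (1 :: complex)) (strip_ends R)"
    using eventually_Re_le_strip_ends
  proof eventually_elim
    case (elim s)
    have "Re s * ln \<alpha> \<le> \<bar>Re s\<bar> * \<bar>ln \<alpha>\<bar>"
      using abs_ge_self[of "Re s * ln \<alpha>"] by (simp add: abs_mult)
    also have "\<dots> \<le> R * \<bar>ln \<alpha>\<bar>"
      using elim by (rule mult_right_mono) simp
    finally show ?case
      using assms by (simp add: norm_powr_real)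
  qed
qed

subsection \<open>Growth of the digamma function\<close>

lemma Re_Digamma_ge_of_Re_ge_1:
  assumes "Re z \<ge> 1"
  shows "harm M - euler_mascheroni - Re (\<Sum>i<M. inverse (z + of_nat i)) \<le> Re (Digamma z)"
proof -
  define f where "f i = inverse (of_nat (Suc i)) - inverse (z + of_nat i)" for i
  have Re_f: "Re (f i) = inverse (real (Suc i)) - Re (inverse (z + of_nat i))" for i
    by (simp add: f_def Re_divide_of_nat inverse_eq_divide del: of_nat_Suc inverse_complex.simps)
  have "Re (f i) \<ge> 0" for i
  proof -
    define x where "x = Re z + real i"
    have x: "x \<ge> real (Suc i)" "x > 0" using assms by (auto simp: x_def)
    have "Re (inverse (z + of_nat i)) = x / (x\<^sup>2 + (Im z)\<^sup>2)" by (simp add: x_def)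
    also have "\<dots> \<le> x / x\<^sup>2" using x by (intro divide_left_mono mult_pos_pos add_pos_nonneg) auto
    also have "\<dots> = inverse x" using x by (simp add: power2_eq_square field_simps)
    also have "\<dots> \<le> inverse (real (Suc i))" using x by (intro le_imp_inverse_le) auto
    finally show ?thesis by (simp only: Re_f diff_ge_0_iff_ge)
  qed
  moreover have "summable f"
    unfolding f_def using assms by (intro summable_Digamma) auto
  ultimately have "(\<Sum>i<M. Re (f i)) \<le> Re (suminf f)"
    by (subst Re_suminf) (auto intro!: sum_le_suminf summable_Re)
  moreover have "(\<Sum>i<M. Re (f i)) = harm M - Re (\<Sum>i<M. inverse (z + of_nat i))"
    by (simp add: Re_f sum_subtractf harm_def sum.atLeast1_atMost_eq del: inverse_complex.simps)
  moreover have "Re euler_mascheroni = euler_mascheroni"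
    by (metis Re_complex_of_real of_real_euler_mascheroni)
  ultimately show ?thesis
    by (simp add: Digamma_def f_def [abs_def] del: inverse_complex.simps)
qed

lemma Re_Digamma_ge:
  assumes "Re z + real N \<ge> 1" "z \<notin> \<int>\<^sub>\<le>\<^sub>0"
  shows "harm M - euler_mascheroni - Re (\<Sum>i<N + M. inverse (z + of_nat i)) \<le> Re (Digamma z)"
proof -
  have "Digamma (z + of_nat N) = Digamma z + (\<Sum>i<N. inverse (z + of_nat i))"
    using assms(2) Polygamma_plus_of_nat[of N z 0] by (auto simp: inverse_eq_divide)
  moreover have "(\<Sum>i<N + M. inverse (z + of_nat i)) =
      (\<Sum>i<N. inverse (z + of_nat i)) + (\<Sum>i<M. inverse (z + of_nat N + of_nat i))"
    by (induction M) (simp_all add: add_ac)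
  ultimately show ?thesis
    using Re_Digamma_ge_of_Re_ge_1[of "z + of_nat N" M] assms(1) by (simp del: inverse_complex.simps)
qed

lemma filterlim_Re_Digamma_at_top: "filterlim (\<lambda>z. Re (Digamma z)) at_top (strip_ends R)"
  unfolding filterlim_at_top
proof
  fix B :: real
  obtain N :: nat where N: "R + 1 \<le> real N"
    using real_arch_simple by blast
  have "eventually (\<lambda>M. harm M \<ge> B + euler_mascheroni + (1 :: real)) sequentially"
    using harm_at_top unfolding filterlim_at_top by blast
  then obtain M where M: "harm M \<ge> B + euler_mascheroni + (1 :: real)"
    unfolding eventually_sequentially by blast
  have "((\<lambda>z. Re (\<Sum>i<N + M. inverse (z + of_nat i))) \<longlongrightarrow> Re (\<Sum>i<N + M. 0)) (strip_ends R)"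
    by (intro tendsto_Re tendsto_sum filterlim_compose[OF tendsto_inverse_0]
        tendsto_add_filterlim_at_infinity'
        filterlim_mono[OF filterlim_ident strip_ends_le_at_infinity] tendsto_const) auto
  then have "eventually (\<lambda>z. Re (\<Sum>i<N + M. inverse (z + of_nat i)) < 1) (strip_ends R)"
    by (intro order_tendstoD(2)) auto
  moreover note eventually_Re_le_strip_ends[of R] eventually_Im_gt_strip_ends[of 0 R]
  ultimately show "eventually (\<lambda>z. B \<le> Re (Digamma z)) (strip_ends R)"
  proof eventually_elim
    case (elim z)
    have "z \<notin> \<int>\<^sub>\<le>\<^sub>0" using elim(3) by (auto elim!: nonpos_Ints_cases)
    moreover have "Re z + real N \<ge> 1" using elim(2) N by linarith
    ultimately show ?case using Re_Digamma_ge[of z N M] elim(1) M by linarith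
  qed
qed

lemma Gamma_mult_has_logderiv:
  fixes h :: "complex \<Rightarrow> complex" and w :: complex
  assumes "s - w \<notin> \<int>\<^sub>\<le>\<^sub>0" "h field_differentiable at s" "h s \<noteq> 0" "c \<noteq> 0"
  defines "g \<equiv> (\<lambda>s. c * Gamma (s - w) * h s)"
  shows "g field_differentiable at s" "deriv g s / g s = Digamma (s - w) + deriv h s / h s"
proof -
  have "((\<lambda>s. Gamma (s - w)) has_field_derivative Gamma (s - w) * Digamma (s - w)) (at s)"
    using assms(1) by (auto intro!: derivative_eq_intros)
  from DERIV_mult[OF DERIV_cmult[OF this] field_differentiable_derivI[OF assms(2)]]
  have deriv_g: "(g has_field_derivative g s * (Digamma (s - w) + deriv h s / h s)) (at s)"
    unfolding g_def by (rule DERIV_cong) (use assms(3) in \<open>simp add: field_simps\<close>)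
  then show "g field_differentiable at s"
    by (auto simp: field_differentiable_def)
  have "g s \<noteq> 0"
    using assms(1,3,4) by (simp add: g_def Gamma_eq_zero_iff)
  then show "deriv g s / g s = Digamma (s - w) + deriv h s / h s"
    using DERIV_imp_deriv[OF deriv_g] by simp
qed

lemma Gamma_mult_Re_logderiv_pos:
  fixes h :: "complex \<Rightarrow> complex" and k :: nat
  assumes "R < R'" "h \<in> O[strip_ends R'](\<lambda>_. 1)"
    and differentiable: "eventually (\<lambda>s. h field_differentiable at s) (strip_ends R')"
    and "e > 0" and lower: "eventually (\<lambda>s. e \<le> norm (h s)) (strip_ends R)" and "c \<noteq> 0"
  defines "g \<equiv> (\<lambda>s. c * Gamma (s - of_nat k) * h s)"
  shows "eventually (\<lambda>s. g field_differentiable at s \<and> Re (deriv g s / g s) > 0) (strip_ends R)"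
proof -
  obtain B where B: "eventually (\<lambda>s. norm (deriv h s / h s) \<le> B) (strip_ends R)"
    using logderiv_bigo_strip_ends[OF assms(1-3) \<open>e > 0\<close> lower] by (auto elim!: landau_o.bigE)
  have "filterlim (\<lambda>s. s - of_nat k) (strip_ends (R + real k)) (strip_ends R)"
    by (rule filterlim_strip_ends) auto
  from filterlim_compose[OF filterlim_Re_Digamma_at_top this]
  have "eventually (\<lambda>s. Re (Digamma (s - of_nat k)) > B) (strip_ends R)"
    by (simp add: filterlim_at_top_dense)
  moreover have "eventually (\<lambda>s. h field_differentiable at s) (strip_ends R)"
    using strip_ends_mono differentiable assms(1) by (metis filter_leD less_imp_le)
  moreover note eventually_Im_gt_strip_ends[of 0 R]
  ultimately show ?thesis
    using B lower
  proof eventually_elim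
    case (elim s)
    have "s - of_nat k \<notin> \<int>\<^sub>\<le>\<^sub>0"
      using elim(3) by (auto elim!: nonpos_Ints_cases simp: complex_eq_iff)
    moreover have "h s \<noteq> 0"
      using elim(5) \<open>e > 0\<close> by auto
    ultimately have "g field_differentiable at s"
        "deriv g s / g s = Digamma (s - of_nat k) + deriv h s / h s"
      unfolding g_def using Gamma_mult_has_logderiv[of s "of_nat k" h c] elim(2) \<open>c \<noteq> 0\<close> by simp_all
    moreover have "\<bar>Re (deriv h s / h s)\<bar> \<le> B"
      using abs_Re_le_cmod elim(4) by (rule order_trans)
    ultimately show ?case
      using elim(1) by simp
  qed
qed

subsection \<open>Functions symmetrized across the imaginary axis\<close>

text \<open>Since $x/0 = 0$, positivity of the real part of \<open>deriv g s / g s\<close> includes \<open>g s \<noteq> 0\<close>.\<close>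

lemma norm_increasing_of_Re_logderiv_pos:
  assumes "a < b"
    and differentiable: "\<And>x. a \<le> x \<Longrightarrow> x \<le> b \<Longrightarrow> g field_differentiable at (Complex x t)"
    and pos: "\<And>x. a \<le> x \<Longrightarrow> x \<le> b \<Longrightarrow> Re (deriv g (Complex x t) / g (Complex x t)) > 0"
  shows "norm (g (Complex a t)) < norm (g (Complex b t))"
proof -
  define h where "h x = g (Complex x t)" for x
  define L where "L x = deriv g (Complex x t) / g (Complex x t)" for x
  have "\<exists>y. ((\<lambda>x. h x \<bullet> h x) has_field_derivative y) (at x) \<and> y > 0" if "a \<le> x" "x \<le> b" for x
  proof -
    have "h x \<noteq> 0"
      using pos[OF that] by (auto simp: h_def)
    have "((\<lambda>w. g (w + \<i> * of_real t)) has_field_derivative deriv g (Complex x t)) (at (of_real x))"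
      using field_differentiable_derivI[OF differentiable[OF that]] unfolding Complex_eq
      by (subst (asm) DERIV_shift) simp
    from has_vector_derivative_real_field[OF this]
    have "(h has_vector_derivative deriv g (Complex x t)) (at x)"
      by (simp add: h_def [abs_def] Complex_eq)
    then have "(h has_vector_derivative h x * L x) (at x)"
      using \<open>h x \<noteq> 0\<close> by (simp add: h_def L_def)
    then have "((\<lambda>x. h x \<bullet> h x) has_field_derivative h x \<bullet> (h x * L x) + (h x * L x) \<bullet> h x) (at x)"
      by (auto intro!: derivative_eq_intros
          bounded_bilinear.has_vector_derivative[OF bounded_bilinear_inner]
          simp: has_real_derivative_iff_has_vector_derivative)
    moreover have "h x \<bullet> (h x * L x) + (h x * L x) \<bullet> h x = 2 * (norm (h x))\<^sup>2 * Re (L x)"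
      unfolding cmod_power2 by (simp add: inner_complex_def algebra_simps power2_eq_square)
    ultimately show ?thesis
      using \<open>h x \<noteq> 0\<close> pos[OF that] by (auto simp: L_def)
  qed
  from DERIV_pos_imp_increasing[OF assms(1) this] have "h a \<bullet> h a < h b \<bullet> h b"
    by blast
  then show ?thesis
    by (simp add: h_def norm_lt)
qed

lemma symmetrized_nonzero:
  assumes "Re s \<noteq> 0"
    and differentiable: "\<And>x. \<bar>x\<bar> \<le> \<bar>Re s\<bar> \<Longrightarrow> g field_differentiable at (Complex x (Im s))"
    and pos: "\<And>x. \<bar>x\<bar> \<le> \<bar>Re s\<bar> \<Longrightarrow> Re (deriv g (Complex x (Im s)) / g (Complex x (Im s))) > 0"
  shows "g s + cnj (g (- cnj s)) \<noteq> 0"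
proof
  assume "g s + cnj (g (- cnj s)) = 0"
  then have "norm (g s) = norm (g (- cnj s))"
    by (metis add_eq_0_iff complex_mod_cnj norm_minus_cancel)
  moreover have "norm (g (Complex (- \<bar>Re s\<bar>) (Im s))) < norm (g (Complex \<bar>Re s\<bar> (Im s)))"
    using assms(1) by (intro norm_increasing_of_Re_logderiv_pos differentiable pos) auto
  moreover have "{s, - cnj s} = {Complex (- \<bar>Re s\<bar>) (Im s), Complex \<bar>Re s\<bar> (Im s)}"
    by (auto simp: complex_eq_iff abs_if)
  ultimately show False
    by (metis doubleton_eq_iff less_irrefl)
qed

lemma deriv_symmetrized_nonzero:
  assumes "Re s = 0" "C s = 0"
    and symmetrized: "eventually (\<lambda>z. C z = g z + cnj (g (- cnj z))) (nhds s)"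
    and "g field_differentiable at s" "Re (deriv g s / g s) > 0"
  shows "deriv C s \<noteq> 0"
proof -
  have reflect: "- cnj s = s"
    using assms(1) by (simp add: complex_eq_iff)
  define L where "L = deriv g s / g s"
  have "g s \<noteq> 0"
    using assms(5) by auto
  then have dg: "(g has_field_derivative g s * L) (at s)"
    using field_differentiable_derivI[OF assms(4)] by (simp add: L_def)
  then have "(g has_field_derivative g s * L) (at (- cnj s))"
    by (simp add: reflect)
  from DERIV_chain2[OF this DERIV_minus[OF DERIV_ident]]
  have "((\<lambda>w. g (- w)) has_field_derivative - (g s * L)) (at (cnj s))"
    by simp
  from has_field_derivative_cnj_cnj[OF this]
  have "((\<lambda>z. cnj (g (- cnj z))) has_field_derivative cnj (- (g s * L))) (at s)"
    by (simp add: o_def)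
  from DERIV_add[OF dg this]
  have "(C has_field_derivative g s * L + cnj (- (g s * L))) (at s)"
    by (subst DERIV_cong_ev[OF refl symmetrized refl])
  then have "deriv C s = g s * L - cnj (g s) * cnj L"
    by (simp add: DERIV_imp_deriv)
  also have "cnj (g s) = - g s"
    using eventually_nhds_x_imp_x[OF symmetrized] assms(2) reflect by (simp add: add_eq_0_iff)
  also have "g s * L - - g s * cnj L = g s * of_real (2 * Re L)"
    by (simp add: complex_eq_iff algebra_simps)
  finally show ?thesis
    using \<open>g s \<noteq> 0\<close> assms(5) by (simp add: L_def)
qed

lemma finite_zeros_entire_rectangle:
  assumes "C holomorphic_on UNIV" "C w \<noteq> 0"
  shows "finite {s. C s = 0 \<and> \<bar>Re s\<bar> \<le> x \<and> \<bar>Im s\<bar> \<le> y}"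
proof (cases "C constant_on UNIV")
  case True
  then show ?thesis
    using assms(2) by (auto simp: constant_on_def)
next
  case False
  then have "finite {s \<in> cbox (Complex (- x) (- y)) (Complex x y). C s = 0}"
    by (intro holomorphic_compact_finite_zeros[OF assms(1)]) auto
  then show ?thesis
    by (rule rev_finite_subset) (auto simp: in_cbox_complex_iff)
qed

theorem finite_exceptional_zeros_symmetrized:
  assumes "C holomorphic_on UNIV" "\<delta> > 0"
    and symmetrized: "\<And>s. Im s \<noteq> 0 \<Longrightarrow> C s = g s + cnj (g (- cnj s))"
    and "eventually (\<lambda>s. g field_differentiable at s \<and> Re (deriv g s / g s) > 0) (strip_ends \<delta>)"
  shows "finite {s. C s = 0 \<and> \<bar>Re s\<bar> \<le> \<delta> \<and> \<not> (Re s = 0 \<and> deriv C s \<noteq> 0)}"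
proof -
  from eventually_conj[OF assms(4) eventually_Im_gt_strip_ends[of 0]]
  obtain T where T: "\<And>s. \<bar>Re s\<bar> \<le> \<delta> \<Longrightarrow> T \<le> \<bar>Im s\<bar> \<Longrightarrow>
      g field_differentiable at s \<and> Re (deriv g s / g s) > 0 \<and> Im s \<noteq> 0"
    unfolding eventually_strip_ends by auto
  have off_axis: "C s \<noteq> 0" if "\<bar>Re s\<bar> \<le> \<delta>" "Re s \<noteq> 0" "T \<le> \<bar>Im s\<bar>" for s
  proof -
    have "g s + cnj (g (- cnj s)) \<noteq> 0"
      using T[of "Complex x (Im s)" for x] that by (intro symmetrized_nonzero) auto
    then show ?thesis
      using T[OF that(1,3)] by (simp add: symmetrized)
  qed
  have on_axis: "deriv C s \<noteq> 0" if "C s = 0" "Re s = 0" "T \<le> \<bar>Im s\<bar>" for s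
  proof (rule deriv_symmetrized_nonzero[where g = g])
    have "Im s \<noteq> 0" using T[of s] that assms(2) by auto
    then have "eventually (\<lambda>z. Im z \<noteq> 0) (nhds s)"
      by (intro eventually_nhds_in_open[of "{z. Im z \<noteq> 0}", simplified])
         (auto intro!: open_Collect_neq continuous_intros)
    then show "eventually (\<lambda>z. C z = g z + cnj (g (- cnj z))) (nhds s)"
      by eventually_elim (rule symmetrized)
  qed (use T[of s] that assms(2) in auto)
  have "C (Complex \<delta> \<bar>T\<bar>) \<noteq> 0"
    using assms(2) by (intro off_axis) auto
  from finite_zeros_entire_rectangle[OF assms(1) this, of \<delta> T] show ?thesis
    by (rule rev_finite_subset) (use off_axis on_axis in \<open>force simp: not_le\<close>)
qed

subsection \<open>Moments and the order of vanishing\<close>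

definition affine_euler_op :: "'a :: idom \<Rightarrow> 'a \<Rightarrow> 'a poly \<Rightarrow> 'a poly" where
  "affine_euler_op u v p = smult u p + smult v ([:0, 1:] * pderiv p)"

lemma coeff_affine_euler_op: "coeff (affine_euler_op u v p) m = (u + v * of_nat m) * coeff p m"
  by (cases m) (simp_all add: affine_euler_op_def coeff_pCons coeff_pderiv algebra_simps)

lemma coeff_affine_euler_op_funpow:
  "coeff ((affine_euler_op u v ^^ j) p) m = (u + v * of_nat m) ^ j * coeff p m"
  by (induction j) (simp_all add: coeff_affine_euler_op mult.assoc)

lemma poly_affine_euler_op_funpow:
  "poly ((affine_euler_op u v ^^ j) (\<Sum>m\<in>M. monom (a m) m)) c = (\<Sum>m\<in>M. a m * (u + v * of_nat m) ^ j * c ^ m)"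
proof -
  have "(affine_euler_op u v ^^ j) (\<Sum>m\<in>M. monom (a m) m) = (\<Sum>m\<in>M. monom (a m * (u + v * of_nat m) ^ j) m)"
    by (rule poly_eqI)
       (auto simp: coeff_affine_euler_op_funpow coeff_sum coeff_monom sum_distrib_left intro!: sum.cong)
  then show ?thesis
    by (simp add: poly_sum poly_monom)
qed

text \<open>The differential operator lowers the order of vanishing at a point other than $0$ by exactly one,
  so the power moments of an arithmetic progression of frequencies detect that order.\<close>

lemma order_affine_euler_op:
  fixes p :: "'a :: field_char_0 poly"
  assumes "v \<noteq> 0" "c \<noteq> 0" "p \<noteq> 0" "order c p = Suc k"
  shows "affine_euler_op u v p \<noteq> 0" "order c (affine_euler_op u v p) = k"
proof -
  define q where "q = smult v ([:0, 1:] * pderiv p)"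
  have "pderiv p \<noteq> 0"
    using order_degree[OF assms(3), of c] assms(4) by (simp add: pderiv_eq_0_iff)
  then have "q \<noteq> 0"
    using assms(1) by (simp add: q_def)
  have "order c [:0, 1:] = 0"
    using assms(2) by (intro order_0I) simp
  moreover have "order c (pderiv p) = k"
    using order_pderiv[OF assms(3), of c] order_root[of p c] assms(4) by simp
  ultimately have "order c q = k"
    using order_mult[of "[:0, 1:]" "pderiv p" c] \<open>pderiv p \<noteq> 0\<close>
    unfolding q_def order_smult[OF assms(1)] by (simp del: mult_pCons_left)
  then have "[:- c, 1:] ^ k dvd q" "\<not> [:- c, 1:] ^ Suc k dvd q"
    using order[OF \<open>q \<noteq> 0\<close>, of c] by auto
  moreover have "[:- c, 1:] ^ Suc k dvd smult u p"
    using order_1[of c p] assms(4) by (simp add: dvd_smult del: power_Suc)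
  moreover from this have "[:- c, 1:] ^ k dvd smult u p"
    by (rule power_le_dvd) simp
  ultimately have divisibility: "[:- c, 1:] ^ k dvd affine_euler_op u v p"
      "\<not> [:- c, 1:] ^ Suc k dvd affine_euler_op u v p"
    unfolding affine_euler_op_def q_def [symmetric] by (simp_all add: dvd_add_right_iff del: power_Suc)
  then show "order c (affine_euler_op u v p) = k"
    by (rule order_unique_lemma)
  show "affine_euler_op u v p \<noteq> 0"
    using divisibility(2) by auto
qed

lemma order_affine_euler_op_funpow:
  fixes p :: "'a :: field_char_0 poly"
  assumes "v \<noteq> 0" "c \<noteq> 0" "p \<noteq> 0" "j \<le> order c p"
  shows "(affine_euler_op u v ^^ j) p \<noteq> 0 \<and> order c ((affine_euler_op u v ^^ j) p) = order c p - j"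
  using assms(4)
proof (induction j)
  case (Suc j)
  then have "order c ((affine_euler_op u v ^^ j) p) = Suc (order c p - Suc j)"
    by simp
  with Suc order_affine_euler_op[OF assms(1,2), of "(affine_euler_op u v ^^ j) p" "order c p - Suc j" u]
  show ?case by simp
qed (use assms(3) in simp)

definition freq :: "nat \<Rightarrow> real" where
  "freq m = pi * real (2 * m + 1)"

definition moment :: "(nat \<Rightarrow> complex) \<Rightarrow> nat \<Rightarrow> nat \<Rightarrow> complex" where
  "moment a n j = (\<Sum>m\<le>n. a m * of_real (freq m) ^ j)"

lemma moment_eq_0_iff:
  assumes "\<exists>m\<le>n. a m \<noteq> 0" "j \<le> order 1 (PF a n)"
  shows "moment a n j = 0 \<longleftrightarrow> j < order 1 (PF a n)"
proof -
  define u v :: complex where "u = of_real pi" and "v = of_real (2 * pi)"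
  have "coeff (PF a n) m = (if m \<le> n then a m else 0)" for m
    by (simp add: PF_def coeff_sum coeff_monom if_distrib cong: if_cong)
  then have "PF a n \<noteq> 0"
    using assms(1) by (metis coeff_0)
  then have "(affine_euler_op u v ^^ j) (PF a n) \<noteq> 0"
      "order 1 ((affine_euler_op u v ^^ j) (PF a n)) = order 1 (PF a n) - j"
    using order_affine_euler_op_funpow[of v 1 "PF a n" j u] assms(2) by (simp_all add: v_def)
  moreover have "moment a n j = poly ((affine_euler_op u v ^^ j) (PF a n)) 1"
    unfolding PF_def poly_affine_euler_op_funpow
    by (simp add: moment_def freq_def u_def v_def algebra_simps)
  ultimately show ?thesis
    using assms(2) by (auto simp: order_root)
qed

lemma freq_pos: "freq m > 0"
  by (simp add: freq_def)

lemma inj_ln_freq: "inj (\<lambda>m. - ln (freq m))"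
  using freq_pos by (intro injI) (simp add: freq_def)

lemma psiF_eq: "psiF a n s = (\<Sum>m\<le>n. a m * of_real (freq m) powr (- s))"
proof -
  have "of_real (freq m) powr (- s) = complex_of_real pi powr (- s) * of_nat (2 * m + 1) powr (- s)" for m
    using powr_times_real[of "of_real pi" "of_real (real (2 * m + 1))" "- s"] by (simp add: freq_def)
  then show ?thesis
    by (simp add: psiF_def sum_distrib_left mult_ac)
qed

lemma psiF_eq_exp_sum: "psiF a n s = exp_sum {..n} a (\<lambda>m. - ln (freq m)) s"
  by (simp add: psiF_eq exp_sum_def powr_def Ln_of_real mult.commute
      freq_pos freq_pos [THEN less_imp_neq, symmetric])

lemma psiF_bounded_below:
  assumes "\<exists>m\<le>n. a m \<noteq> 0" "u < u'" "v' < v"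
    and "\<And>s. u < Re s \<Longrightarrow> Re s < v \<Longrightarrow> psiF a n s \<noteq> 0"
  shows "\<exists>e>0. \<forall>s. u' \<le> Re s \<longrightarrow> Re s \<le> v' \<longrightarrow> e \<le> norm (psiF a n s)"
  unfolding psiF_eq_exp_sum
  by (rule exp_sum_bounded_below[where u = u and v = v])
     (use assms inj_ln_freq in \<open>auto simp: psiF_eq_exp_sum [symmetric] intro: inj_on_subset\<close>)

subsection \<open>The decomposition of the transform\<close>

definition freq_form :: "(nat \<Rightarrow> complex) \<Rightarrow> nat \<Rightarrow> (real \<Rightarrow> real \<Rightarrow> complex) \<Rightarrow> complex" where
  "freq_form a n K = (\<Sum>m\<le>n. \<Sum>l\<le>n. a m * cnj (a l) * K (freq m) (freq l))"

lemma freq_form_cong: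
  "(\<And>\<alpha> \<beta>. \<alpha> > 0 \<Longrightarrow> \<beta> > 0 \<Longrightarrow> K \<alpha> \<beta> = L \<alpha> \<beta>) \<Longrightarrow> freq_form a n K = freq_form a n L"
  by (simp add: freq_form_def freq_pos)

lemma freq_form_add: "freq_form a n (\<lambda>\<alpha> \<beta>. K \<alpha> \<beta> + L \<alpha> \<beta>) = freq_form a n K + freq_form a n L"
  by (simp add: freq_form_def distrib_left sum.distrib)

lemma freq_form_mult_left: "freq_form a n (\<lambda>\<alpha> \<beta>. c * K \<alpha> \<beta>) = c * freq_form a n K"
  by (simp add: freq_form_def sum_distrib_left mult_ac)

lemma freq_form_sum: "freq_form a n (\<lambda>\<alpha> \<beta>. \<Sum>j\<in>J. K j \<alpha> \<beta>) = (\<Sum>j\<in>J. freq_form a n (K j))"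
  unfolding freq_form_def sum_distrib_left by (subst sum.swap) (subst sum.swap, rule refl)

lemma cnj_freq_form: "cnj (freq_form a n K) = freq_form a n (\<lambda>\<alpha> \<beta>. cnj (K \<beta> \<alpha>))"
  unfolding freq_form_def by (subst sum.swap) (simp add: mult_ac)

lemma freq_form_mult_power:
  "freq_form a n (\<lambda>\<alpha> \<beta>. f \<alpha> * of_real \<beta> ^ j) = (\<Sum>m\<le>n. a m * f (freq m)) * cnj (moment a n j)"
  by (simp add: freq_form_def moment_def sum_product mult_ac)

lemma freq_form_bigo:
  assumes "\<And>\<alpha> \<beta>. \<alpha> > 0 \<Longrightarrow> \<beta> > 0 \<Longrightarrow> (\<lambda>s. K s \<alpha> \<beta>) \<in> O[F](f)"
  shows "(\<lambda>s. freq_form a n (K s)) \<in> O[F](f)"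
  unfolding freq_form_def using assms freq_pos
  by (intro big_sum_in_bigo landau_o.big.cmult_in_iff' landau_o.big.mult_in_1) auto

lemma freq_form_tendsto:
  assumes "\<And>\<alpha> \<beta>. \<alpha> > 0 \<Longrightarrow> \<beta> > 0 \<Longrightarrow> ((\<lambda>s. K s \<alpha> \<beta>) \<longlongrightarrow> L \<alpha> \<beta>) F"
  shows "((\<lambda>s. freq_form a n (K s)) \<longlongrightarrow> freq_form a n L) F"
  unfolding freq_form_def by (intro tendsto_intros assms freq_pos)

lemma freq_form_holomorphic:
  assumes "\<And>\<alpha> \<beta>. \<alpha> > 0 \<Longrightarrow> \<beta> > 0 \<Longrightarrow> (\<lambda>s. K s \<alpha> \<beta>) holomorphic_on A"
  shows "(\<lambda>s. freq_form a n (K s)) holomorphic_on A"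
  unfolding freq_form_def by (intro holomorphic_intros assms freq_pos)

lemma CF_eq_freq_form: "CF a n s = freq_form a n (\<lambda>\<alpha> \<beta>. bessel_integral \<alpha> \<beta> s)"
proof -
  have "complex_of_real (exp (- 2 * pi * cosh t)) * of_real (exp (- 2 * pi * real m * exp t)) *
      of_real (exp (- 2 * pi * real l * exp (- t))) * exp (s * of_real t) =
      bessel_integrand (freq m) (freq l) s t" for m l t
  proof -
    have "exp (- 2 * pi * cosh t) * exp (- 2 * pi * real m * exp t) * exp (- 2 * pi * real l * exp (- t)) =
        exp (- freq m * exp t - freq l * exp (- t))"
      unfolding exp_add [symmetric]
      by (rule arg_cong[of _ _ exp]) (simp add: cosh_def freq_def algebra_simps)
    then show ?thesis
      by (simp only: bessel_integrand_def exp_add exp_of_real flip: of_real_mult)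
  qed
  then have "phiF a n t * exp (\<i> * (- \<i> * s) * of_real t) =
      freq_form a n (\<lambda>\<alpha> \<beta>. bessel_integrand \<alpha> \<beta> s t)" for t
    unfolding freq_form_def phiF_def
    by (simp add: sum_distrib_left sum_distrib_right sum_product mult_ac)
  then have "CF a n s = (LBINT t. freq_form a n (\<lambda>\<alpha> \<beta>. bessel_integrand \<alpha> \<beta> s t))"
    by (simp only: CF_def XiF_def)
  also have "\<dots> = freq_form a n (\<lambda>\<alpha> \<beta>. bessel_integral \<alpha> \<beta> s)"
    by (simp add: freq_form_def bessel_integral_def integrable_bessel_integrand freq_pos)
  finally show ?thesis .
qed

lemma CF_holomorphic: "CF a n holomorphic_on A"
  unfolding CF_eq_freq_form [abs_def] by (intro freq_form_holomorphic bessel_integral_holomorphic)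

definition CF_part :: "(nat \<Rightarrow> complex) \<Rightarrow> nat \<Rightarrow> complex \<Rightarrow> complex" where
  "CF_part a n s = freq_form a n (\<lambda>\<alpha> \<beta>. bessel_part \<alpha> \<beta> s)"

lemma CF_eq_CF_part:
  assumes "s \<notin> \<int>"
  shows "CF a n s = CF_part a n s + cnj (CF_part a n (- cnj s))"
proof -
  have "cnj (bessel_part \<alpha> \<beta> (- cnj s)) = bessel_part \<alpha> \<beta> (- s)" if "\<alpha> > 0" for \<alpha> \<beta>
    using cnj_bessel_part[OF that, of "- cnj s"] assms by simp
  then have "cnj (CF_part a n (- cnj s)) = freq_form a n (\<lambda>\<alpha> \<beta>. bessel_part \<beta> \<alpha> (- s))"
    unfolding CF_part_def cnj_freq_form by (intro freq_form_cong) simp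
  then show ?thesis
    using bessel_integral_eq_sum[OF _ _ assms]
    by (simp add: CF_eq_freq_form CF_part_def freq_form_add [symmetric] cong: freq_form_cong)
qed

definition CF_reduced_part :: "(nat \<Rightarrow> complex) \<Rightarrow> nat \<Rightarrow> nat \<Rightarrow> complex \<Rightarrow> complex" where
  "CF_reduced_part a n k s = freq_form a n (\<lambda>\<alpha> \<beta>. bessel_reduced_part k \<alpha> \<beta> s)"

lemma Gamma_eq_pochhammer_mult:
  fixes s :: complex
  assumes "s \<notin> \<int>"
  shows "Gamma s = (- 1) ^ k * pochhammer (1 - s) k * Gamma (s - of_nat k)"
proof -
  have "s - of_nat k \<notin> \<int>"
    using assms by simp
  then have "s - of_nat k \<notin> \<int>\<^sub>\<le>\<^sub>0" "Gamma (s - of_nat k) \<noteq> 0"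
    by (auto simp: Gamma_nonzero_of_notin_Ints)
  then have "Gamma s = pochhammer (s - of_nat k) k * Gamma (s - of_nat k)"
    using pochhammer_Gamma[of "s - of_nat k" k] by simp
  then show ?thesis
    using pochhammer_minus'[of "s - 1" k] by (simp add: algebra_simps)
qed

text \<open>The partial sum of order $k$ of the series ${}_0F_1$ contributes nothing, because the moments of
  order less than $k$ vanish.\<close>

lemma CF_part_eq_Gamma_mult:
  assumes "s \<notin> \<int>" and moments: "\<And>j. j < k \<Longrightarrow> moment a n j = 0"
  shows "CF_part a n s = (- 1) ^ k * Gamma (s - of_nat k) * CF_reduced_part a n k s"
proof -
  define monomial where "monomial j \<alpha> \<beta> = of_real \<alpha> powr (of_nat j - s) * of_real \<beta> ^ j"
    for j and \<alpha> \<beta> :: real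
  have "pochhammer (1 - s) k \<noteq> 0"
    using assms(1) pochhammer_eq_0_imp_nonpos_Int nonpos_Ints_Int by fastforce
  moreover have "CF_part a n s =
      Gamma s * ((\<Sum>j<k. 1 / (fact j * pochhammer (1 - s) j) * freq_form a n (monomial j)) +
        1 / pochhammer (1 - s) k * CF_reduced_part a n k s)"
    unfolding CF_part_def CF_reduced_part_def monomial_def [abs_def] freq_form_mult_left [symmetric]
      freq_form_sum [symmetric] freq_form_add [symmetric]
    by (intro freq_form_cong bessel_part_eq_partial_sum_plus_reduced_part assms(1))
  moreover have "freq_form a n (monomial j) = 0" if "j < k" for j
    unfolding monomial_def [abs_def] freq_form_mult_power by (simp add: moments that)
  ultimately show ?thesis
    by (simp add: Gamma_eq_pochhammer_mult[OF assms(1), of k])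
qed

subsection \<open>Asymptotics in vertical strips\<close>

lemma hyp0F1_tail_tendsto_strip_ends: "(hyp0F1_tail k x \<longlongrightarrow> 1 / fact k) (strip_ends R)"
proof (rule LIM_zero_cancel, rule Lim_null_comparison)
  have "eventually (\<lambda>z. 1 < \<bar>Im z\<bar>) (strip_ends R)"
    by (rule eventually_Im_gt_strip_ends)
  then show "eventually (\<lambda>z. norm (hyp0F1_tail k x z - 1 / fact k) \<le> norm x * exp (norm x) / norm z)
      (strip_ends R)"
  proof eventually_elim
    case (elim z)
    have "1 \<le> norm (z + of_nat i)" for i
      using abs_Im_le_cmod[of "z + of_nat i"] elim by simp
    from norm_hyp0F1_tail_minus_le[OF zero_less_one this] show ?case by simp
  qed
  have "filterlim (\<lambda>z. norm z) at_top (strip_ends R)"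
    using filterlim_norm_at_top strip_ends_le_at_infinity by (rule filterlim_mono[OF _ order_refl])
  then show "((\<lambda>z. norm x * exp (norm x) / norm z) \<longlongrightarrow> 0) (strip_ends R)"
    by (intro tendsto_divide_0[OF tendsto_const] filterlim_at_top_imp_at_infinity)
qed

lemma filterlim_reflect_strip_ends:
  "filterlim (\<lambda>s. of_nat c - s) (strip_ends (R + real c)) (strip_ends R)"
  by (rule filterlim_strip_ends) auto

lemma hyp0F1_tail_reflect_tendsto:
  "((\<lambda>s. hyp0F1_tail k x (1 - s + of_nat k)) \<longlongrightarrow> 1 / fact k) (strip_ends R)"
  using filterlim_compose[OF hyp0F1_tail_tendsto_strip_ends filterlim_reflect_strip_ends[of "Suc k"]]
  by (simp add: algebra_simps)

lemma powr_reflect_bigo: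
  assumes "\<alpha> > 0"
  shows "(\<lambda>s. of_real \<alpha> powr (of_nat k - s)) \<in> O[strip_ends R](\<lambda>_. 1)"
  using landau_o.big.compose[OF powr_bigo_strip_ends[OF assms] filterlim_reflect_strip_ends] .

lemma bessel_reduced_part_bigo:
  assumes "\<alpha> > 0"
  shows "bessel_reduced_part k \<alpha> \<beta> \<in> O[strip_ends R](\<lambda>_. 1)"
proof -
  have "(\<lambda>s. hyp0F1_tail k (of_real (\<alpha> * \<beta>)) (1 - s + of_nat k)) \<in> O[strip_ends R](\<lambda>_. 1)"
    using hyp0F1_tail_reflect_tendsto by (intro bigoI_tendsto) auto
  from landau_o.big.mult[OF landau_o.big.mult[OF powr_reflect_bigo[OF assms] bigo_const] this]
  show ?thesis
    by (simp add: bessel_reduced_part_def [abs_def])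
qed

lemma bessel_reduced_part_asymptotics:
  assumes "\<alpha> > 0"
  shows "((\<lambda>s. bessel_reduced_part k \<alpha> \<beta> s -
      1 / fact k * (of_real \<alpha> powr (of_nat k - s) * of_real \<beta> ^ k)) \<longlongrightarrow> 0)
    (strip_ends R)"
proof -
  have "(\<lambda>s. hyp0F1_tail k (of_real (\<alpha> * \<beta>)) (1 - s + of_nat k) - 1 / fact k) \<in> o[strip_ends R](\<lambda>_. 1)"
    using hyp0F1_tail_reflect_tendsto by (intro smalloI_tendsto) (auto intro: LIM_zero)
  from landau_o.big_small_mult[OF landau_o.big.mult[OF powr_reflect_bigo[OF assms] bigo_const] this]
  have "(\<lambda>s. bessel_reduced_part k \<alpha> \<beta> s - 1 / fact k * (of_real \<alpha> powr (of_nat k - s) * of_real \<beta> ^ k))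
      \<in> o[strip_ends R](\<lambda>_. 1)"
    by (simp add: bessel_reduced_part_def right_diff_distrib mult_ac)
  from smalloD_tendsto[OF this] show ?thesis
    by simp
qed

lemma bessel_reduced_part_holomorphic:
  assumes "\<alpha> > 0"
  shows "bessel_reduced_part k \<alpha> \<beta> holomorphic_on {s. Im s \<noteq> 0}"
proof -
  have "hyp0F1_tail k (of_real (\<alpha> * \<beta>)) \<circ> (\<lambda>s. 1 - s + of_nat k) holomorphic_on {s. Im s \<noteq> 0}"
    by (rule holomorphic_on_compose_gen[where t = "{s. Im s \<noteq> 0}"] hyp0F1_tail_holomorphic)
       (auto intro!: holomorphic_intros hyp0F1_tail_holomorphic elim!: nonpos_Ints_cases)
  then have "(\<lambda>s. hyp0F1_tail k (of_real (\<alpha> * \<beta>)) (1 - s + of_nat k)) holomorphic_on {s. Im s \<noteq> 0}"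
    by (simp add: o_def)
  then show ?thesis
    unfolding bessel_reduced_part_def [abs_def] using assms by (intro holomorphic_intros) auto
qed

lemma CF_reduced_part_bigo: "CF_reduced_part a n k \<in> O[strip_ends R](\<lambda>_. 1)"
  unfolding CF_reduced_part_def [abs_def] by (intro freq_form_bigo bessel_reduced_part_bigo)

lemma CF_reduced_part_asymptotics:
  "((\<lambda>s. CF_reduced_part a n k s - cnj (moment a n k) / fact k * psiF a n (s - of_nat k)) \<longlongrightarrow> 0)
    (strip_ends R)"
proof -
  define leading where "leading s \<alpha> \<beta> = 1 / fact k * (complex_of_real \<alpha> powr (of_nat k - s) * of_real \<beta> ^ k)"
    for s and \<alpha> \<beta> :: real
  have leading_sum: "freq_form a n (leading s) =
      cnj (moment a n k) / fact k * psiF a n (s - of_nat k)" for s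
    unfolding leading_def [abs_def] freq_form_mult_left freq_form_mult_power by (simp add: psiF_eq)
  have "CF_reduced_part a n k s =
      freq_form a n (\<lambda>\<alpha> \<beta>. (bessel_reduced_part k \<alpha> \<beta> s - leading s \<alpha> \<beta>) + leading s \<alpha> \<beta>)" for s
    by (simp add: CF_reduced_part_def)
  then have "CF_reduced_part a n k s - cnj (moment a n k) / fact k * psiF a n (s - of_nat k) =
      freq_form a n (\<lambda>\<alpha> \<beta>. bessel_reduced_part k \<alpha> \<beta> s - leading s \<alpha> \<beta>)" for s
    unfolding freq_form_add leading_sum by simp
  moreover have "((\<lambda>s. freq_form a n (\<lambda>\<alpha> \<beta>. bessel_reduced_part k \<alpha> \<beta> s - leading s \<alpha> \<beta>)) \<longlongrightarrow>
      freq_form a n (\<lambda>_ _. 0)) (strip_ends R)"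
    unfolding leading_def by (intro freq_form_tendsto bessel_reduced_part_asymptotics)
  ultimately show ?thesis
    by (simp add: freq_form_def)
qed

lemma CF_reduced_part_holomorphic: "CF_reduced_part a n k holomorphic_on {s. Im s \<noteq> 0}"
  unfolding CF_reduced_part_def [abs_def] by (intro freq_form_holomorphic bessel_reduced_part_holomorphic)

lemma CF_reduced_part_differentiable:
  "eventually (\<lambda>s. CF_reduced_part a n k field_differentiable at s) (strip_ends R)"
  using eventually_Im_gt_strip_ends[of 0]
  by eventually_elim
     (auto intro!: holomorphic_on_imp_differentiable_at[OF CF_reduced_part_holomorphic]
        open_Collect_neq continuous_intros)

lemma CF_reduced_part_bounded_below:
  assumes "moment a n k \<noteq> 0" "e > 0" and "\<And>s. \<bar>Re s\<bar> \<le> R \<Longrightarrow> e \<le> norm (psiF a n (s - of_nat k))"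
  shows "\<exists>e'>0. eventually (\<lambda>s. e' \<le> norm (CF_reduced_part a n k s)) (strip_ends R)"
proof -
  define c where "c = cnj (moment a n k) / fact k"
  define e' where "e' = norm c * e / 2"
  have "e' > 0" using assms(1,2) by (simp add: e'_def c_def)
  then have "eventually (\<lambda>s. norm (CF_reduced_part a n k s - c * psiF a n (s - of_nat k)) < e')
      (strip_ends R)"
    using CF_reduced_part_asymptotics[of a n k R] by (simp add: tendsto_iff c_def)
  then have "eventually (\<lambda>s. e' \<le> norm (CF_reduced_part a n k s)) (strip_ends R)"
    using eventually_Re_le_strip_ends
  proof eventually_elim
    case (elim s)
    have "2 * e' \<le> norm (c * psiF a n (s - of_nat k))"
      using assms(3)[OF elim(2)] by (simp add: e'_def norm_mult mult_left_mono)
    then show ?case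
      using elim(1) norm_triangle_ineq2[of "c * psiF a n (s - of_nat k)" "CF_reduced_part a n k s"]
      by (simp add: norm_minus_commute)
  qed
  with \<open>e' > 0\<close> show ?thesis by blast
qed

theorem theorem3:
  fixes a :: "nat \<Rightarrow> complex" and n k :: nat and D1 D2 \<delta> :: real
  assumes nonzero: "\<exists>m\<le>n. a m \<noteq> 0"
    and k_def: "k = order 1 (PF a n)"
    and D1_pos: "0 < D1" and D1_D2: "D1 < D2"
    and no_zeros: "\<And>s. - D2 < Re s \<Longrightarrow> Re s < D1 \<Longrightarrow> psiF a n (s - of_nat k) \<noteq> 0"
    and delta: "0 < \<delta>" "\<delta> < D1"
  shows "finite {s. CF a n s = 0 \<and> \<bar>Re s\<bar> \<le> \<delta> \<and> \<not> (Re s = 0 \<and> deriv (CF a n) s \<noteq> 0)}"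
proof -
  have moments: "moment a n j = 0 \<longleftrightarrow> j < k" if "j \<le> k" for j
    using moment_eq_0_iff[OF nonzero] that by (simp add: k_def)
  have "psiF a n s \<noteq> 0" if "- D2 - real k < Re s" "Re s < D1 - real k" for s
    using no_zeros[of "s + of_nat k"] that by simp
  then obtain e where e: "e > 0" "\<And>s. - \<delta> - real k \<le> Re s \<Longrightarrow> Re s \<le> \<delta> - real k \<Longrightarrow> e \<le> norm (psiF a n s)"
    using psiF_bounded_below[OF nonzero, of "- D2 - real k" "- \<delta> - real k" "\<delta> - real k" "D1 - real k"]
      delta D1_D2 by auto
  then obtain e' where "e' > 0" "eventually (\<lambda>s. e' \<le> norm (CF_reduced_part a n k s)) (strip_ends \<delta>)"
    using CF_reduced_part_bounded_below[of a n k e \<delta>] moments[of k] by force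
  note logderiv_pos = Gamma_mult_Re_logderiv_pos[OF _ CF_reduced_part_bigo
      CF_reduced_part_differentiable this, of "\<delta> + 1" "(- 1) ^ k" k]
  show ?thesis
  proof (rule finite_exceptional_zeros_symmetrized[OF CF_holomorphic \<open>0 < \<delta>\<close> _ logderiv_pos])
    fix s :: complex assume "Im s \<noteq> 0"
    then have "s \<notin> \<int>" "- cnj s \<notin> \<int>" by (auto elim!: Ints_cases)
    then show "CF a n s = (- 1) ^ k * Gamma (s - of_nat k) * CF_reduced_part a n k s +
        cnj ((- 1) ^ k * Gamma (- cnj s - of_nat k) * CF_reduced_part a n k (- cnj s))"
      using CF_eq_CF_part[of s a n] CF_part_eq_Gamma_mult[of _ k a n] moments by simp
  qed auto
qed

end
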